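(* Suppose $K\in\mathcal D_1$ is diagonalizable (over $\mathbf C$). Suppose also that there exist $\theta_k\in\Theta_{h_k}$ ($k=1,\dots,n$), with $h_k$ non-negative integers, such that $[\theta_j,\theta_k]=0$ for all $j,k$, and such that the matrices $\theta_jK^{2j-1}$ ($j=1,\dots,n$) are linearly independent. Then the functions $E^{(k)}_p(\theta_k)$ ($k=1,\dots,n$; $p=1,\dots,r$) of the coordinates $\phi_{j\sigma}$ are functionally independent in a dense open subset of $\mathbf R^{2n\times r}$.
   Context: Algebraic setting. $W$ is a $2n\times 2n$ invertible antisymmetric real matrix. $G=\{A\in GL(2n,\mathbf C): A^TWA=W\}$ and $\mathfrak g=\{X\in gl(2n,\mathbf C): X^T=-WXW^{-1}\}$ is its Lie algebra. $\mathrm{pr}:G\to G/\{\pm I\}$ is the projection. $G_0$ is a finite subgroup of $G$ such that every $A\in G_0$ satisfies $\bar AA=\pm I$ (bar = entrywise complex conjugation); then $\mathrm{pr}(G_0)$ is Abelian. $\Omega_1,\dots,\Omega_N\in G_0$ are such that $\mathrm{pr}(\Omega_1),\dots,\mathrm{pr}(\Omega_N)$ generate $\mathrm{pr}(G_0)$, and $m_a$ is the order of $\mathrm{pr}(\Omega_a)$, so $\Omega_a^{m_a}=\pm I$. $m_0$ is the least common multiple of $m_1,\dots,m_N$. $\Sigma_0=\{\alpha=(\alpha_1,\dots,\alpha_N)\in\mathbf Z^N: 0\le\alpha_a<m_a\}$ and $\Omega^\alpha=\Omega_1^{\alpha_1}\cdots\Omega_N^{\alpha_N}$. $\omega:G_0\to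 S^1=\{z\in\mathbf C:|z|=1\}$ is a group homomorphism with $\omega(\pm I)=1$; $\omega_a=\omega(\Omega_a)$ and $\omega^\alpha=\omega_1^{\alpha_1}\cdots\omega_N^{\alpha_N}$. $\mathcal D_1=\{X\in\mathfrak g: \bar X=X,\ \Omega X\Omega^{-1}=\omega(\Omega)X\text{ for all }\Omega\in G_0\}$. For an integer $h$, $\Theta_h$ is the set of matrices $\theta=cg$ with $c\in S^1$, $g\in G_0$, such that $\bar\theta=\theta$, $\omega(g)=1$, $\theta^T=W\theta W^{-1}$, and $\Omega\theta\Omega^{-1}=\omega(\Omega)^h\theta$ for all $\Omega\in G_0$. Lax matrix. $\lambda_1,\dots,\lambda_r$ are non-zero real numbers with $\lambda_1^2,\dots,\lambda_r^2$ distinct, $\kappa\neq0$ is a real constant, $\Phi_\sigma=(\phi_{1\sigma},\dots,\phi_{2n,\sigma})^T$ are real column vectors, and $$L(\lambda)=K+\kappa\sum_{\alpha\in\Sigma_0}\sum_{\sigma=1}^r\frac{\Omega^\alpha\Phi_\sigma\Phi_\sigma^T(\Omega^\alpha)^TW}{\lambda-\omega^\alpha\lambda_\sigma}.$$ Functions. For $\theta\in\Theta_h$ expand at $\lambda=\infty$: $\mathrm{tr}(\theta L(\lambda)^{2k})=\sum_{j=0}^\infty s^{(2k)}_j(\theta)\lambda^{-j}$, and set $E^{(k)}_p(\theta)=\frac1{2k}s^{(2k)}_{m_0(p-1)+2k+h}(\theta)$ (for $E^{(k)}_p(\theta_k)$ one uses $h=h_k$). These are real polynomial functions on $\mathbf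 R^{2n\times r}$. Functionally independent at a point means that their differentials are linearly independent there. *)

theory Defs
  imports "HOL-Analysis.Analysis" "HOL-Algebra.Multiplicative_Group"
    "HOL-Algebra.Generated_Groups"
begin

subsection \<open>Matrices\<close>

abbreviation cmat :: "real^'m^'m \<Rightarrow> complex^'m^'m" where
  "cmat \<equiv> map_matrix complex_of_real"

abbreviation conj_mat :: "complex^'m^'m \<Rightarrow> complex^'m^'m" where
  "conj_mat \<equiv> map_matrix cnj"

abbreviation cscale :: "complex \<Rightarrow> complex^'m^'m \<Rightarrow> complex^'m^'m" where
  "cscale c \<equiv> map_matrix ((*) c)"

text \<open>The product inherited from the type \<open>vec\<close> is componentwise, so \<open>A ^ k\<close>
  would not be the matrix power.\<close>

primrec mat_power :: "complex^'m^'m \<Rightarrow> nat \<Rightarrow> complex^'m^'m" where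
  "mat_power A 0 = mat 1"
| "mat_power A (Suc k) = A ** mat_power A k"

definition mat_diagonalizable :: "complex^'m^'m \<Rightarrow> bool" where
  "mat_diagonalizable A \<longleftrightarrow>
     (\<exists>P D :: complex^'m^'m. invertible P \<and> (\<forall>i j. i \<noteq> j \<longrightarrow> D $ i $ j = 0) \<and>
        A = P ** D ** matrix_inv P)"


subsection \<open>The group \<open>G\<close>, its Lie algebra, and the projection modulo \<open>\<plusminus>I\<close>\<close>

definition sp_group :: "real^'m^'m \<Rightarrow> (complex^'m^'m) monoid" where
  "sp_group W =
     \<lparr>carrier = {A. invertible A \<and> transpose A ** cmat W ** A = cmat W},
      monoid.mult = (**), one = mat 1\<rparr>"

definition sp_algebra :: "real^'m^'m \<Rightarrow> (complex^'m^'m) set" where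
  "sp_algebra W = {X. transpose X = - (cmat W ** X ** matrix_inv (cmat W))}"

definition proj_group :: "real^'m^'m \<Rightarrow> (complex^'m^'m) set monoid" where
  "proj_group W = sp_group W Mod {mat 1, - mat 1}"

definition pr :: "real^'m^'m \<Rightarrow> complex^'m^'m \<Rightarrow> (complex^'m^'m) set" where
  "pr W A = {mat 1, - mat 1} #>\<^bsub>sp_group W\<^esub> A"

definition pr_ord :: "real^'m^'m \<Rightarrow> complex^'m^'m \<Rightarrow> nat" where
  "pr_ord W A = group.ord (proj_group W) (pr W A)"

definition circle_group :: "complex monoid" where
  "circle_group = \<lparr>carrier = {z. norm z = 1}, monoid.mult = (*), one = 1\<rparr>"


subsection \<open>The reduction group data\<close>

definition reduced_D1 ::
  "real^'m^'m \<Rightarrow> (complex^'m^'m) set \<Rightarrow> (complex^'m^'m \<Rightarrow> complex) \<Rightarrow> (complex^'m^'m) set" where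
  "reduced_D1 W G0 \<omega> =
     {X \<in> sp_algebra W. conj_mat X = X \<and>
        (\<forall>A\<in>G0. A ** X ** matrix_inv A = cscale (\<omega> A) X)}"

definition Theta ::
  "real^'m^'m \<Rightarrow> (complex^'m^'m) set \<Rightarrow> (complex^'m^'m \<Rightarrow> complex) \<Rightarrow> int \<Rightarrow> (complex^'m^'m) set" where
  "Theta W G0 \<omega> h =
     {\<theta>. \<exists>c g. norm c = 1 \<and> g \<in> G0 \<and> \<theta> = cscale c g \<and> conj_mat \<theta> = \<theta> \<and> \<omega> g = 1 \<and>
          transpose \<theta> = cmat W ** \<theta> ** matrix_inv (cmat W) \<and>
          (\<forall>A\<in>G0. A ** \<theta> ** matrix_inv A = cscale (\<omega> A powi h) \<theta>)}"

text \<open>The generators are \<open>\<Omega> 1, \<dots>, \<Omega> N\<close>; the values of \<open>\<Omega>\<close> outside \<open>{1..N}\<close> play no role.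
  Multi-indices are extensional functions on \<open>{1..N}\<close>.\<close>

definition Sigma0 :: "real^'m^'m \<Rightarrow> nat \<Rightarrow> (nat \<Rightarrow> complex^'m^'m) \<Rightarrow> (nat \<Rightarrow> nat) set" where
  "Sigma0 W N \<Omega> = (\<Pi>\<^sub>E a\<in>{1..N}. {0..<pr_ord W (\<Omega> a)})"

definition m0 :: "real^'m^'m \<Rightarrow> nat \<Rightarrow> (nat \<Rightarrow> complex^'m^'m) \<Rightarrow> nat" where
  "m0 W N \<Omega> = Lcm ((\<lambda>a. pr_ord W (\<Omega> a)) ` {1..N})"

definition Omega_pow :: "nat \<Rightarrow> (nat \<Rightarrow> complex^'m^'m) \<Rightarrow> (nat \<Rightarrow> nat) \<Rightarrow> complex^'m^'m" where
  "Omega_pow N \<Omega> \<alpha> = foldr (\<lambda>a B. mat_power (\<Omega> a) (\<alpha> a) ** B) [1..<Suc N] (mat 1)"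

definition omega_pow ::
  "(complex^'m^'m \<Rightarrow> complex) \<Rightarrow> nat \<Rightarrow> (nat \<Rightarrow> complex^'m^'m) \<Rightarrow> (nat \<Rightarrow> nat) \<Rightarrow> complex" where
  "omega_pow \<omega> N \<Omega> \<alpha> = (\<Prod>a\<in>{1..N}. \<omega> (\<Omega> a) ^ \<alpha> a)"


subsection \<open>Lax matrix and the functions \<open>E\<close>\<close>

text \<open>\<open>\<Phi> $ \<sigma>\<close> is the column vector with entries \<open>\<phi>\<^bsub>j\<sigma>\<^esub> = \<Phi> $ \<sigma> $ j\<close>.\<close>

definition outer :: "real^'m \<Rightarrow> complex^'m^'m" where
  "outer v = (\<chi> i j. complex_of_real (v $ i * v $ j))"

definition lax ::
  "real^'m^'m \<Rightarrow> nat \<Rightarrow> (nat \<Rightarrow> complex^'m^'m) \<Rightarrow> (complex^'m^'m \<Rightarrow> complex) \<Rightarrow>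
   complex^'m^'m \<Rightarrow> real \<Rightarrow> ('r \<Rightarrow> real) \<Rightarrow> real^'m^'r::finite \<Rightarrow> complex \<Rightarrow> complex^'m^'m" where
  "lax W N \<Omega> \<omega> K \<kappa> l \<Phi> z =
     K + cscale (of_real \<kappa>)
       (\<Sum>\<alpha>\<in>Sigma0 W N \<Omega>. \<Sum>\<sigma>\<in>UNIV.
          cscale (1 / (z - omega_pow \<omega> N \<Omega> \<alpha> * of_real (l \<sigma>)))
            (Omega_pow N \<Omega> \<alpha> ** outer (\<Phi> $ \<sigma>) ** transpose (Omega_pow N \<Omega> \<alpha>) ** cmat W))"

text \<open>Coefficients of the convergent expansion \<open>f z = (\<Sum>j. s j * z ^ (-j))\<close> at infinity.\<close>

definition coeffs_at_infinity :: "(complex \<Rightarrow> complex) \<Rightarrow> nat \<Rightarrow> complex" where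
  "coeffs_at_infinity f =
     (THE s. \<forall>\<^sub>F z in at_infinity. (\<lambda>j. s j / z ^ j) sums f z)"

text \<open>For data as above the coefficients are real, because \<open>K\<close> and \<open>\<theta>\<close> are real and
  \<open>conj_mat (L z) = L (cnj z)\<close> (conjugation maps \<open>\<Omega>\<^sup>\<alpha>\<close> to \<open>\<plusminus>\<close> its inverse);
  \<open>Re\<close> only changes the type.\<close>

definition E_fun ::
  "real^'m^'m \<Rightarrow> nat \<Rightarrow> (nat \<Rightarrow> complex^'m^'m) \<Rightarrow> (complex^'m^'m \<Rightarrow> complex) \<Rightarrow>
   complex^'m^'m \<Rightarrow> real \<Rightarrow> ('r \<Rightarrow> real) \<Rightarrow> nat \<Rightarrow> complex^'m^'m \<Rightarrow> nat \<Rightarrow> nat \<Rightarrow>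
   real^'m^'r::finite \<Rightarrow> real" where
  "E_fun W N \<Omega> \<omega> K \<kappa> l h \<theta> k p \<Phi> =
     1 / (2 * real k) *
     Re (coeffs_at_infinity (\<lambda>z. trace (\<theta> ** mat_power (lax W N \<Omega> \<omega> K \<kappa> l \<Phi> z) (2 * k)))
           (m0 W N \<Omega> * (p - 1) + 2 * k + h))"


subsection \<open>Linear and functional independence of families\<close>

text \<open>\<open>independent\<close> is a property of sets; a linearly independent family must in addition
  have no repetitions.\<close>

definition independent_family :: "'i set \<Rightarrow> ('i \<Rightarrow> 'b::real_vector) \<Rightarrow> bool" where
  "independent_family I f \<longleftrightarrow> inj_on f I \<and> independent (f ` I)"

definition functionally_independent_at ::
  "'i set \<Rightarrow> ('i \<Rightarrow> 'a::real_normed_vector \<Rightarrow> real) \<Rightarrow> 'a \<Rightarrow> bool" where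
  "functionally_independent_at I f x \<longleftrightarrow>
     (\<exists>D :: 'i \<Rightarrow> 'a \<Rightarrow>\<^sub>L real.
        (\<forall>i\<in>I. (f i has_derivative blinfun_apply (D i)) (at x)) \<and> independent_family I D)"

end

theory Submission
  imports Defs
begin

text \<open>
  Since \<open>L(\<infinity>) = K\<close> and the remaining coefficients of \<open>L\<close> are quadratic in \<open>\<Phi>\<close>, each
  \<open>E\<^sup>(\<^sup>k\<^sup>)\<^sub>p(\<theta>\<^sub>k)\<close> is a polynomial in \<open>\<Phi>\<close> without linear term. Writing \<open>T\<^sub>k = \<theta>\<^sub>k K\<^bsup>2k-1\<^esup>\<close>,
  its quadratic part is the corresponding coefficient of \<open>tr (T\<^sub>k L)\<close>, because \<open>\<omega>(g) = 1\<close> makes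
  \<open>\<theta>\<^sub>k\<close> commute with \<open>K\<close>. The summands of \<open>L\<close> are conjugate under \<open>\<Omega>\<^sup>\<alpha>\<close>, and \<open>\<omega>\<^sub>a\<close> raised to
  the power \<open>m\<^sub>0\<close> is \<open>1\<close>, so up to a nonzero constant the quadratic part equals
  \<open>\<Sum>\<^sub>\<sigma> \<lambda>\<^sub>\<sigma>\<^bsup>m\<^sub>0(p-1)+2k+h\<^sub>k-1\<^esup> \<Phi>\<^sub>\<sigma>\<^sup>T W T\<^sub>k \<Phi>\<^sub>\<sigma>\<close> with \<open>W T\<^sub>k\<close> symmetric.

  The matrices \<open>K, \<theta>\<^sub>1, \<dots>, \<theta>\<^sub>n\<close> are simultaneously diagonalizable, hence some real vector \<open>u\<close> makes
  \<open>T\<^sub>1 u, \<dots>, T\<^sub>n u\<close> independent. With all \<open>\<Phi>\<^sub>\<sigma> = u\<close>, the Vandermonde argument in the distinct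
  numbers \<open>\<lambda>\<^sub>\<sigma>\<^bsup>m\<^sub>0\<^esup>\<close> shows that the differentials of the quadratic parts are independent.
  Scaling \<open>\<Phi>\<close> towards \<open>0\<close> carries independence over to the functions themselves at one point,
  and by polynomiality it then holds on a dense open set.
\<close>

subsection \<open>Generic linear independence\<close>

text \<open>Coefficients rather than sets of functions are used, so repeated members count as
  dependent. The argument \<open>v\<close> may be a coordinate, a matrix position or a direction,
  which lets one notion cover vectors, matrices and differentials over both real and complex
  scalars.\<close>

definition indep_funs :: "'i set \<Rightarrow> ('i \<Rightarrow> 'v \<Rightarrow> 'a::field) \<Rightarrow> bool" where
  "indep_funs I F \<longleftrightarrow> (\<forall>a. (\<forall>v. (\<Sum>i\<in>I. a i * F i v) = 0) \<longrightarrow> (\<forall>i\<in>I. a i = 0))"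

lemma indep_funs_cong:
  assumes "\<And>i v. i \<in> I \<Longrightarrow> F i v = G i v"
  shows "indep_funs I F \<longleftrightarrow> indep_funs I G"
  unfolding indep_funs_def using assms by (simp cong: sum.cong)

text \<open>Fraction-free Gaussian elimination: \<open>g\<close> is a product of pivots and plays
  the role of a non-vanishing minor. The class \<A> only has to survive products and differences, so
  the same argument serves functions continuous at a point, real polynomial functions and complex
  polynomials.\<close>

lemma indep_funs_generic:
  fixes F :: "'x \<Rightarrow> 'i \<Rightarrow> 'v \<Rightarrow> 'a::field"
  assumes "finite I"
    and one: "(\<lambda>x. 1) \<in> \<A>"
    and mult: "\<And>f g. f \<in> \<A> \<Longrightarrow> g \<in> \<A> \<Longrightarrow> (\<lambda>x. f x * g x) \<in> \<A>"
    and diff: "\<And>f g. f \<in> \<A> \<Longrightarrow> g \<in> \<A> \<Longrightarrow> (\<lambda>x. f x - g x) \<in> \<A>"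
    and F: "\<And>i v. i \<in> I \<Longrightarrow> (\<lambda>x. F x i v) \<in> \<A>"
    and indep: "indep_funs I (F x0)"
  shows "\<exists>g\<in>\<A>. g x0 \<noteq> 0 \<and> (\<forall>x. g x \<noteq> 0 \<longrightarrow> indep_funs I (F x))"
  using \<open>finite I\<close> F indep
proof (induction I arbitrary: F rule: finite_induct)
  case empty
  then show ?case using one by (intro bexI[of _ "\<lambda>x. 1"]) (auto simp: indep_funs_def)
next
  case (insert i I)
  have "\<exists>v. F x0 i v \<noteq> 0"
  proof (rule ccontr)
    assume "\<nexists>v. F x0 i v \<noteq> 0"
    then have "\<forall>v. (\<Sum>j\<in>insert i I. (if j = i then 1 else 0) * F x0 j v) = 0"
      using insert.hyps by (auto intro!: sum.neutral)
    from insert.prems(2)[unfolded indep_funs_def, rule_format, OF this[rule_format], of i]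
    show False by simp
  qed
  then obtain v where v: "F x0 i v \<noteq> 0" by blast
  \<comment> \<open>One step of Gaussian elimination with pivot \<open>F x i v\<close>.\<close>
  define F' where "F' x j u = F x i v * F x j u - F x j v * F x i u" for x j u
  \<comment> \<open>A relation with coefficients \<open>a\<close> among the eliminated rows lifts to
    a relation \<open>b\<close> among the original ones; the coefficient at \<open>i\<close>
    collects what the elimination subtracted.\<close>
  have relation: "(\<Sum>j\<in>insert i I. b j * F x j u) =
      (\<Sum>j\<in>I. a j * F' x j u)"
    if b: "b = (\<lambda>j. if j = i then - (\<Sum>j\<in>I. a j * F x j v) else a j * F x i v)" for a b x u
  proof -
    have "(\<Sum>j\<in>insert i I. b j * F x j u) =
        - (\<Sum>j\<in>I. a j * F x j v) * F x i u + (\<Sum>j\<in>I. a j * F x i v * F x j u)"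
      using insert.hyps unfolding b by (auto intro!: sum.cong)
    also have "\<dots> = (\<Sum>j\<in>I. a j * F' x j u)"
      by (simp add: F'_def algebra_simps sum_subtractf sum_distrib_left)
    finally show ?thesis .
  qed
  have "indep_funs I (F' x0)"
    unfolding indep_funs_def
  proof (intro allI impI ballI)
    fix a j assume a: "\<forall>u. (\<Sum>j\<in>I. a j * F' x0 j u) = 0" and j: "j \<in> I"
    define b where "b = (\<lambda>j. if j = i then - (\<Sum>j\<in>I. a j * F x0 j v) else a j * F x0 i v)"
    have "\<forall>u. (\<Sum>j\<in>insert i I. b j * F x0 j u) = 0"
      using a relation[OF b_def] by simp
    then have "b j = 0" using insert.prems(2) j unfolding indep_funs_def by blast
    then show "a j = 0" using v j insert.hyps by (auto simp: b_def split: if_splits)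
  qed
  moreover have "(\<lambda>x. F' x j u) \<in> \<A>" if "j \<in> I" for j u
    unfolding F'_def using that insert.prems(1) by (intro diff mult) auto
  ultimately obtain g where g: "g \<in> \<A>" "g x0 \<noteq> 0" "\<And>x. g x \<noteq> 0 \<Longrightarrow> indep_funs I (F' x)"
    using insert.IH[of F'] by blast
  show ?case
  proof (intro bexI conjI allI impI)
    show "(\<lambda>x. g x * F x i v) \<in> \<A>" using g insert.prems by (intro mult) auto
    show "g x0 * F x0 i v \<noteq> 0" using g v by simp
    fix x assume x: "g x * F x i v \<noteq> 0"
    show "indep_funs (insert i I) (F x)"
      unfolding indep_funs_def
    proof (intro allI impI)
      fix a assume a: "\<forall>u. (\<Sum>j\<in>insert i I. a j * F x j u) = 0"
      have split: "(\<Sum>j\<in>I. a j * F x j u) = - a i * F x i u" for u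
        using a[rule_format, of u] insert.hyps by (simp add: add_eq_0_iff)
      have "(\<Sum>j\<in>I. a j * F' x j u) = 0" for u
      proof -
        have "(\<Sum>j\<in>I. a j * F' x j u) = F x i v * (\<Sum>j\<in>I. a j * F x j u) - F x i u * (\<Sum>j\<in>I. a j * F x j v)"
          by (simp add: F'_def algebra_simps sum_subtractf sum_distrib_left)
        then show ?thesis by (simp add: split)
      qed
      then have aI: "\<forall>j\<in>I. a j = 0" using g(3)[of x] x unfolding indep_funs_def by auto
      then have "a i * F x i v = 0" using split[of v] by simp
      with x aI show "\<forall>j\<in>insert i I. a j = 0" by auto
    qed
  qed
qed

subsection \<open>Expansions at infinity\<close>

text \<open>Under \<open>w = 1 / z\<close> an expansion at infinity becomes a power series at 0, and
  power series coefficients are unique. Uniqueness is what gives the definite description its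
  value.\<close>

lemma coeffs_at_infinity_eq:
  assumes "g has_fps_expansion F" "\<And>w. w \<noteq> 0 \<Longrightarrow> g w = f (1 / w)"
  shows "coeffs_at_infinity f = fps_nth F"
proof -
  have ev: "(\<forall>\<^sub>F z in at_infinity. P z) \<longleftrightarrow> (\<forall>\<^sub>F w in at 0. P (1 / w))" for P :: "complex \<Rightarrow> bool"
    by (simp only: at_to_infinity eventually_filtermap inverse_eq_divide) simp
  show ?thesis
    unfolding coeffs_at_infinity_def
  proof (rule the_equality)
    have eval: "\<forall>\<^sub>F w in nhds 0. eval_fps F w = g w" and radius: "fps_conv_radius F > 0"
      using assms(1) by (auto simp: has_fps_expansion_def)
    have "\<forall>\<^sub>F w in nhds 0. w \<in> eball 0 (fps_conv_radius F)"
      using radius by (intro eventually_nhds_in_open) (auto simp: zero_ereal_def)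
    with eval have "\<forall>\<^sub>F w in nhds 0. (\<lambda>j. fps_nth F j * w ^ j) sums g w"
      by eventually_elim
        (auto simp: eval_fps_def sums_iff intro!: summable_fps)
    then have "\<forall>\<^sub>F w in at 0. (\<lambda>j. fps_nth F j * w ^ j) sums g w"
      by (rule eventually_nhds_conv_at[THEN iffD1, THEN conjunct1])
    then show "\<forall>\<^sub>F z in at_infinity. (\<lambda>j. fps_nth F j / z ^ j) sums f z"
      unfolding ev using eventually_neq_at_within[of 0 0 UNIV]
      by eventually_elim (simp add: assms(2) power_one_over divide_simps)
  next
    fix s :: "nat \<Rightarrow> complex"
    assume "\<forall>\<^sub>F z in at_infinity. (\<lambda>j. s j / z ^ j) sums f z"
    then have s: "\<forall>\<^sub>F w in at 0. (\<lambda>j. s j * w ^ j) sums g w"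
      unfolding ev using eventually_neq_at_within[of 0 0 UNIV]
      by eventually_elim (simp add: assms(2) power_one_over divide_simps)
    \<comment> \<open>The hypothesis on \<open>s\<close> concerns only \<open>w \<noteq> 0\<close>,
      so the value at 0 is set to \<open>s 0\<close>. Continuity of both functions then forces
      \<open>g' = g\<close>.\<close>
    define g' where "g' w = (if w = 0 then s 0 else g w)" for w
    have "\<forall>\<^sub>F w in nhds 0. (\<lambda>j. fps_nth (Abs_fps s) j * w ^ j) sums g' w"
      using s unfolding eventually_at_filter
      by eventually_elim (auto simp: g'_def)
    then have g': "g' has_fps_expansion Abs_fps s" by (rule has_fps_expansionI)
    have "(g \<longlongrightarrow> g 0) (at 0)" "(g' \<longlongrightarrow> g' 0) (at 0)"
      using has_fps_expansion_imp_continuous[OF assms(1), of UNIV]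
        has_fps_expansion_imp_continuous[OF g', of UNIV] by (auto simp: continuous_within)
    moreover have "(g' \<longlongrightarrow> g' 0) (at 0) \<longleftrightarrow> (g \<longlongrightarrow> g' 0) (at 0)"
      by (intro tendsto_cong) (auto simp: eventually_at_filter g'_def)
    ultimately have "g 0 = g' 0" by (metis tendsto_unique trivial_limit_at)
    then have "g' = g" by (auto simp: g'_def)
    with g' have "g has_fps_expansion Abs_fps s" by simp
    then have "fps_nth (Abs_fps s) j = fps_nth F j" for j
      by (simp only: fps_nth_fps_expansion[OF assms(1)] fps_nth_fps_expansion)
    then show "s = fps_nth F" by auto
  qed
qed

text \<open>Iterated Cauchy products: the coefficient at degree \<open>d\<close> of the
  \<open>k\<close>-th power of the matrix power series with coefficients \<open>A\<close>.\<close>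

primrec power_coeff :: "(nat \<Rightarrow> complex^'m^'m) \<Rightarrow> nat \<Rightarrow> nat \<Rightarrow> complex^'m^'m" where
  "power_coeff A 0 d = (if d = 0 then mat 1 else 0)"
| "power_coeff A (Suc k) d = (\<Sum>e=0..d. A e ** power_coeff A k (d - e))"

lemma has_fps_expansion_mat_power:
  fixes M :: "complex \<Rightarrow> complex^'m^'m"
  assumes "\<And>i j. (\<lambda>w. M w $ i $ j) has_fps_expansion Abs_fps (\<lambda>d. A d $ i $ j)"
  shows "(\<lambda>w. mat_power (M w) k $ i $ j) has_fps_expansion Abs_fps (\<lambda>d. power_coeff A k d $ i $ j)"
proof (induction k arbitrary: i j)
  case 0
  have "Abs_fps (\<lambda>d. power_coeff A 0 d $ i $ j) = fps_const (mat 1 $ i $ j)"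
    by (auto simp: fps_eq_iff)
  then show ?case by simp
next
  case (Suc k)
  have "Abs_fps (\<lambda>d. power_coeff A (Suc k) d $ i $ j) =
     (\<Sum>l\<in>UNIV. Abs_fps (\<lambda>d. A d $ i $ l) * Abs_fps (\<lambda>d. power_coeff A k d $ l $ j))"
    unfolding fps_eq_iff
    by (auto simp: fps_sum_nth fps_mult_nth matrix_matrix_mult_def intro: sum.swap)
  then show ?case
    using assms Suc.IH
    by (auto simp: matrix_matrix_mult_def intro!: has_fps_expansion_sum has_fps_expansion_mult)
qed

text \<open>For \<open>w = 1 / z\<close> the function is \<open>1 / (z - c)\<close>, the scalar
  factor of a pole of the Lax matrix. The extra factor \<open>w\<close> shifts the geometric series
  by one degree.\<close>

lemma has_fps_expansion_geometric:
  fixes c :: complex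
  shows "(\<lambda>w. w / (1 - c * w)) has_fps_expansion Abs_fps (\<lambda>d. if d = 0 then 0 else c ^ (d - 1))"
proof -
  have ev: "\<forall>\<^sub>F w in nhds 0. norm (c * w) < 1"
  proof -
    have "isCont (\<lambda>w. norm (c * w)) 0" by (intro continuous_intros)
    then have "((\<lambda>w. norm (c * w)) \<longlongrightarrow> norm (c * 0)) (nhds 0)"
      by (simp add: isCont_def tendsto_nhds_iff)
    then show ?thesis by (rule order_tendstoD) simp
  qed
  show ?thesis
    apply (rule has_fps_expansionI)
    using ev
  proof eventually_elim
    case (elim w)
    have "(\<lambda>d. w * (c * w) ^ d) sums (w * (1 / (1 - c * w)))"
      by (intro sums_mult geometric_sums elim)
    then have "(\<lambda>d. (if Suc d = 0 then 0 else c ^ (Suc d - 1)) * w ^ Suc d) sums (w / (1 - c * w))"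
      by (simp add: power_mult_distrib algebra_simps)
    then show ?case
      by (subst (asm) sums_Suc_iff) simp
  qed
qed

subsection \<open>Second-order jets at the origin\<close>

text \<open>The coordinates are real while the matrix entries are complex, so polynomiality is asked
  of the real and imaginary parts.\<close>

definition cpoly :: "('a::real_normed_vector \<Rightarrow> complex) \<Rightarrow> bool" where
  "cpoly f \<longleftrightarrow> real_polynomial_function (\<lambda>x. Re (f x)) \<and> real_polynomial_function (\<lambda>x. Im (f x))"

lemma cpoly_const: "cpoly (\<lambda>x. c)"
  by (auto simp: cpoly_def)

lemma cpoly_add: "cpoly f \<Longrightarrow> cpoly g \<Longrightarrow> cpoly (\<lambda>x. f x + g x)"
  by (auto simp: cpoly_def)

lemma cpoly_mult: "cpoly f \<Longrightarrow> cpoly g \<Longrightarrow> cpoly (\<lambda>x. f x * g x)"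
  by (auto simp: cpoly_def)

lemma cpoly_of_real: "real_polynomial_function f \<Longrightarrow> cpoly (\<lambda>x. of_real (f x))"
  by (auto simp: cpoly_def)

text \<open>\<open>has_jet f c Q\<close>: \<open>f\<close> is a polynomial function with constant term \<open>c\<close>, no linear term,
  and second derivative \<open>Q\<close> at \<open>0\<close>.\<close>

definition has_jet ::
  "('a::real_normed_vector \<Rightarrow> complex) \<Rightarrow> complex \<Rightarrow> ('a \<Rightarrow> 'a \<Rightarrow> complex) \<Rightarrow> bool" where
  "has_jet f c Q \<longleftrightarrow> cpoly f \<and> f 0 = c \<and>
     (\<exists>D. (\<forall>x. (f has_derivative D x) (at x)) \<and> (\<forall>v. cpoly (\<lambda>x. D x v)) \<and>
       (\<forall>x v. ((\<lambda>t. D (t *\<^sub>R x) v /\<^sub>R t) \<longlongrightarrow> Q x v) (at 0)))"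

lemma has_jet_const: "has_jet (\<lambda>x. c) c (\<lambda>x v. 0)"
  unfolding has_jet_def
  by (auto intro!: cpoly_const exI[of _ "\<lambda>x v. 0"])

text \<open>Products of two coordinates are the only way in which the variables enter the Lax
  matrix. The differential is linear in \<open>x\<close>, so its quotient by \<open>t\<close> along
  \<open>t *\<^sub>R x\<close> is constant for \<open>t \<noteq> 0\<close>.\<close>

lemma has_jet_quadratic:
  fixes a b :: "'a::real_normed_vector \<Rightarrow> real"
  assumes a: "bounded_linear a" and b: "bounded_linear b"
  shows "has_jet (\<lambda>x. of_real (a x * b x)) 0 (\<lambda>x v. of_real (a x * b v + a v * b x))"
  unfolding has_jet_def
proof (intro conjI exI[of _ "\<lambda>x v. of_real (a x * b v + a v * b x)"] allI)
  interpret a: bounded_linear a by fact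
  interpret b: bounded_linear b by fact
  show "cpoly (\<lambda>x. of_real (a x * b x))" using a b by (intro cpoly_of_real) auto
  show "of_real (a 0 * b 0) = 0" by (simp add: a.zero)
  show "cpoly (\<lambda>x. of_real (a x * b v + a v * b x))" for v
    by (intro cpoly_of_real real_polynomial_function.intros(2-4)
        real_polynomial_function.intros(1)[OF a] real_polynomial_function.intros(1)[OF b])
  show "((\<lambda>x. complex_of_real (a x * b x)) has_derivative (\<lambda>v. of_real (a x * b v + a v * b x))) (at x)" for x
    by (intro has_derivative_of_real has_derivative_mult a.has_derivative b.has_derivative
        has_derivative_ident)
  have "of_real (a (t *\<^sub>R x) * b v + a v * b (t *\<^sub>R x)) /\<^sub>R t = complex_of_real (a x * b v + a v * b x)"
    if "t \<noteq> 0" for x v t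
  proof -
    have "a (t *\<^sub>R x) * b v + a v * b (t *\<^sub>R x) = t * (a x * b v + a v * b x)"
      by (simp add: a.scaleR b.scaleR algebra_simps)
    then show ?thesis using that by (simp add: scaleR_conv_of_real del: of_real_add)
  qed
  then show "((\<lambda>t. of_real (a (t *\<^sub>R x) * b v + a v * b (t *\<^sub>R x)) /\<^sub>R t) \<longlongrightarrow> 
     complex_of_real (a x * b v + a v * b x)) (at 0)" for x v
    by (intro tendsto_eventually) (auto simp: eventually_at_filter)
qed

lemma has_jet_add:
  assumes "has_jet f c P" "has_jet g d Q"
  shows "has_jet (\<lambda>x. f x + g x) (c + d) (\<lambda>x v. P x v + Q x v)"
proof -
  from assms(1) obtain D where
    D: "cpoly f" "f 0 = c" "\<And>x. (f has_derivative D x) (at x)" "\<And>v. cpoly (\<lambda>x. D x v)"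
       "\<And>x v. ((\<lambda>t. D (t *\<^sub>R x) v /\<^sub>R t) \<longlongrightarrow> P x v) (at 0)"
    unfolding has_jet_def by blast
  from assms(2) obtain E where
    E: "cpoly g" "g 0 = d" "\<And>x. (g has_derivative E x) (at x)" "\<And>v. cpoly (\<lambda>x. E x v)"
       "\<And>x v. ((\<lambda>t. E (t *\<^sub>R x) v /\<^sub>R t) \<longlongrightarrow> Q x v) (at 0)"
    unfolding has_jet_def by blast
  show ?thesis unfolding has_jet_def
    using D E
    by (intro conjI exI[of _ "\<lambda>x v. D x v + E x v"] allI)
      (auto simp: scaleR_add_right intro!: cpoly_add has_derivative_add tendsto_add)
qed

text \<open>Without linear terms the mixed products of first derivatives vanish at 0, so second
  derivatives obey the plain Leibniz rule. In the limit the undifferentiated factors tend to their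
  values at 0 by continuity.\<close>

lemma has_jet_mult:
  assumes "has_jet f c P" "has_jet g d Q"
  shows "has_jet (\<lambda>x. f x * g x) (c * d) (\<lambda>x v. c * Q x v + P x v * d)"
proof -
  from assms(1) obtain D where
    D: "cpoly f" "f 0 = c" "\<And>x. (f has_derivative D x) (at x)" "\<And>v. cpoly (\<lambda>x. D x v)"
       "\<And>x v. ((\<lambda>t. D (t *\<^sub>R x) v /\<^sub>R t) \<longlongrightarrow> P x v) (at 0)"
    unfolding has_jet_def by blast
  from assms(2) obtain E where
    E: "cpoly g" "g 0 = d" "\<And>x. (g has_derivative E x) (at x)" "\<And>v. cpoly (\<lambda>x. E x v)"
       "\<And>x v. ((\<lambda>t. E (t *\<^sub>R x) v /\<^sub>R t) \<longlongrightarrow> Q x v) (at 0)"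
    unfolding has_jet_def by blast
  have lim: "((\<lambda>t. F (t *\<^sub>R x)) \<longlongrightarrow> F 0) (at 0)"
    if "\<And>x. (F has_derivative F' x) (at x)" for F :: "'a \<Rightarrow> complex" and F' and x
  proof (rule isCont_tendsto_compose[of 0 F])
    show "isCont F 0" using that has_derivative_continuous by blast
    show "((\<lambda>t. t *\<^sub>R x) \<longlongrightarrow> 0) (at 0)" by (auto intro!: tendsto_eq_intros)
  qed
  have "((\<lambda>t. f (t *\<^sub>R x) * (E (t *\<^sub>R x) v /\<^sub>R t) + (D (t *\<^sub>R x) v /\<^sub>R t) * g (t *\<^sub>R x))
      \<longlongrightarrow> f 0 * Q x v + P x v * g 0) (at 0)" for x v
    by (intro tendsto_add tendsto_mult D(5) E(5) lim[OF D(3)] lim[OF E(3)])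
  then show ?thesis unfolding has_jet_def
    using D E
    by (intro conjI exI[of _ "\<lambda>x v. f x * E x v + D x v * g x"] allI)
      (auto simp: scaleR_add_right intro!: cpoly_add cpoly_mult has_derivative_mult)
qed

lemma has_jet_sum:
  assumes "\<And>i. i \<in> I \<Longrightarrow> has_jet (f i) (c i) (Q i)"
  shows "has_jet (\<lambda>x. \<Sum>i\<in>I. f i x) (\<Sum>i\<in>I. c i) (\<lambda>x v. \<Sum>i\<in>I. Q i x v)"
proof (cases "finite I")
  case True
  then show ?thesis using assms
    by (induction I rule: finite_induct) (simp_all add: has_jet_const has_jet_add)
qed (simp add: has_jet_const)

definition has_mat_jet ::
  "('a::real_normed_vector \<Rightarrow> complex^'m^'m) \<Rightarrow> complex^'m^'m \<Rightarrow> ('a \<Rightarrow> 'a \<Rightarrow> complex^'m^'m) \<Rightarrow> bool" where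
  "has_mat_jet f C Q \<longleftrightarrow> (\<forall>i j. has_jet (\<lambda>x. f x $ i $ j) (C $ i $ j) (\<lambda>x v. Q x v $ i $ j))"

lemma has_mat_jet_const: "has_mat_jet (\<lambda>x. C) C (\<lambda>x v. 0)"
  by (simp add: has_mat_jet_def has_jet_const)

lemma has_mat_jet_sum:
  assumes "\<And>i. i \<in> I \<Longrightarrow> has_mat_jet (f i) (C i) (Q i)"
  shows "has_mat_jet (\<lambda>x. \<Sum>i\<in>I. f i x) (\<Sum>i\<in>I. C i) (\<lambda>x v. \<Sum>i\<in>I. Q i x v)"
  using assms by (simp add: has_mat_jet_def has_jet_sum)

lemma has_mat_jet_mult:
  assumes "has_mat_jet f C P" "has_mat_jet g D Q"
  shows "has_mat_jet (\<lambda>x. f x ** g x) (C ** D) (\<lambda>x v. C ** Q x v + P x v ** D)"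
  using assms
  by (simp add: has_mat_jet_def matrix_matrix_mult_def has_jet_sum has_jet_mult flip: sum.distrib)

lemma has_mat_jet_mult_left:
  "has_mat_jet f D Q \<Longrightarrow> has_mat_jet (\<lambda>x. C ** f x) (C ** D) (\<lambda>x v. C ** Q x v)"
  using has_mat_jet_mult[OF has_mat_jet_const[of C], of f D Q] by simp

lemma has_mat_jet_mult_right:
  "has_mat_jet f D Q \<Longrightarrow> has_mat_jet (\<lambda>x. f x ** C) (D ** C) (\<lambda>x v. Q x v ** C)"
  using has_mat_jet_mult[OF _ has_mat_jet_const[of C], of f D Q] by simp

lemma has_mat_jet_cscale:
  assumes "has_mat_jet f C Q"
  shows "has_mat_jet (\<lambda>x. cscale c (f x)) (cscale c C) (\<lambda>x v. cscale c (Q x v))"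
  unfolding has_mat_jet_def
proof (intro allI)
  fix i j
  have "has_jet (\<lambda>x. c * f x $ i $ j) (c * C $ i $ j) (\<lambda>x v. c * Q x v $ i $ j + 0 * C $ i $ j)"
    using assms by (intro has_jet_mult has_jet_const) (simp add: has_mat_jet_def)
  then show "has_jet (\<lambda>x. cscale c (f x) $ i $ j) (cscale c C $ i $ j) (\<lambda>x v. cscale c (Q x v) $ i $ j)"
    by simp
qed

lemma has_jet_trace:
  assumes "has_mat_jet f C Q"
  shows "has_jet (\<lambda>x. trace (f x)) (trace C) (\<lambda>x v. trace (Q x v))"
  using assms unfolding trace_def has_mat_jet_def by (intro has_jet_sum) auto

lemma matrix_mult_sum_right:
  "A ** (\<Sum>i\<in>I. B i) = (\<Sum>i\<in>I. A ** B i)" for A :: "'a::semiring_1^'n^'m"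
  by (induction I rule: infinite_finite_induct) (simp_all add: matrix_add_ldistrib)

text \<open>At the origin only the coefficient of degree 0 survives and equals \<open>K\<close>.
  Hence the one differentiated factor must carry the whole degree \<open>d\<close>, and the sum runs
  over its position \<open>a\<close> among the \<open>k\<close> factors.\<close>

lemma has_mat_jet_power_coeff:
  fixes A :: "'a::real_normed_vector \<Rightarrow> nat \<Rightarrow> complex^'m^'m"
  assumes "\<And>d. has_mat_jet (\<lambda>x. A x d) (if d = 0 then K else 0) (M d)"
  shows "has_mat_jet (\<lambda>x. power_coeff (A x) k d) (if d = 0 then mat_power K k else 0)
     (\<lambda>x v. \<Sum>a<k. mat_power K a ** M d x v ** mat_power K (k - 1 - a))"
proof (induction k arbitrary: d)
  case 0
  show ?case by (simp add: has_mat_jet_const)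
next
  case (Suc k)
  let ?Q = "\<lambda>k d x v. \<Sum>a<k. mat_power K a ** M d x v ** mat_power K (k - 1 - a)"
  let ?K = "\<lambda>e. if e = 0 then K else 0" and ?P = "\<lambda>e. if e = 0 then mat_power K k else 0"
  have jet: "has_mat_jet (\<lambda>x. power_coeff (A x) (Suc k) d) (\<Sum>e=0..d. ?K e ** ?P (d - e))
     (\<lambda>x v. \<Sum>e=0..d. ?K e ** ?Q k (d - e) x v + M e x v ** ?P (d - e))"
    unfolding power_coeff.simps by (intro has_mat_jet_sum has_mat_jet_mult assms Suc.IH)
  \<comment> \<open>Both parts of the convolution collapse to one term: \<open>e = 0\<close> when
    the left factor is evaluated at the origin, \<open>e = d\<close> when the right factor
    is.\<close>
  have *: "?K e ** X = (if e = 0 then K ** X else 0)" for e and X :: "complex^'m^'m" by simp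
  have **: "Y ** ?P (d - e) = (if e = d then Y ** mat_power K k else 0)"
    if "e \<in> {0..d}" for e and Y :: "complex^'m^'m" using that by auto
  have "(\<Sum>e=0..d. ?K e ** ?P (d - e)) = (if d = 0 then mat_power K (Suc k) else 0)"
    by (simp add: * sum.delta del: times0_left)
  moreover have "(\<Sum>e=0..d. ?K e ** ?Q k (d - e) x v + M e x v ** ?P (d - e)) = ?Q (Suc k) d x v" for x v
  proof -
    have "(\<Sum>e=0..d. ?K e ** ?Q k (d - e) x v + M e x v ** ?P (d - e)) =
        (\<Sum>e=0..d. if e = 0 then K ** ?Q k (d - e) x v else 0) + 
        (\<Sum>e=0..d. if e = d then M e x v ** mat_power K k else 0)"
      unfolding sum.distrib by (intro arg_cong2[of _ _ _ _ "(+)"] sum.cong) (auto simp: * **)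
    also have "\<dots> = M d x v ** mat_power K k + K ** ?Q k d x v"
      by simp
    also have "K ** ?Q k d x v = (\<Sum>a<k. mat_power K (Suc a) ** M d x v ** mat_power K (k - 1 - a))"
      by (simp add: matrix_mult_sum_right matrix_mul_assoc)
    finally show ?thesis by (subst sum.lessThan_Suc_shift) simp
  qed
  ultimately show ?case using jet by (simp only:)
qed

section \<open>From second derivatives at the origin to generic functional independence\<close>

lemma independent_familyI:
  assumes I: "finite I" and zero: "\<And>a. (\<Sum>i\<in>I. a i *\<^sub>R f i) = 0 \<Longrightarrow> \<forall>i\<in>I. a i = 0"
  shows "independent_family I f"
proof -
  have inj: "inj_on f I"
  proof (rule inj_onI, rule ccontr)
    fix i j assume ij: "i \<in> I" "j \<in> I" "f i = f j" "i \<noteq> j"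
    let ?a = "\<lambda>k. if k = i then 1 else if k = j then - 1 else (0::real)"
    have "(\<Sum>k\<in>I. ?a k *\<^sub>R f k) = (\<Sum>k\<in>{i, j}. ?a k *\<^sub>R f k)"
      using ij I by (intro sum.mono_neutral_right) auto
    then have "(\<Sum>k\<in>I. ?a k *\<^sub>R f k) = 0" using ij by simp
    from zero[OF this, rule_format, OF ij(1)] show False by simp
  qed
  moreover have "independent (f ` I)"
  proof (rule real_vector.independent_if_scalars_zero)
    fix u x assume "(\<Sum>x\<in>f ` I. u x *\<^sub>R x) = 0" "x \<in> f ` I"
    then show "u x = 0" using zero[of "u \<circ> f"] by (auto simp: sum.reindex[OF inj])
  qed (use I in simp)
  ultimately show ?thesis by (simp add: independent_family_def)
qed

lemma independent_familyD:
  assumes "independent_family I f" "finite I" "(\<Sum>i\<in>I. a i *\<^sub>R f i) = 0" "i \<in> I"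
  shows "a i = 0"
proof -
  have inj: "inj_on f I" and ind: "independent (f ` I)"
    using assms(1) by (auto simp: independent_family_def)
  have "(\<Sum>x\<in>f ` I. a (inv_into I f x) *\<^sub>R x) = 0"
    using assms(3) inj by (simp add: sum.reindex inv_into_f_f)
  from real_vector.independentD[OF ind _ subset_refl this, of "f i"]
  show ?thesis using assms(2,4) inj by simp
qed

text \<open>On the line from any \<open>x\<close> to \<open>x1\<close> the polynomial
  \<open>g\<close> becomes a polynomial in one variable that is non-zero at 1. It has finitely many
  roots, so points of the line arbitrarily close to \<open>x\<close> avoid them.\<close>

lemma closure_nonzero_polynomial:
  fixes g :: "'a::euclidean_space \<Rightarrow> real"
  assumes g: "real_polynomial_function g" and x1: "g x1 \<noteq> 0"
  shows "closure {x. g x \<noteq> 0} = UNIV"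
proof -
  have "x \<in> closure {x. g x \<noteq> 0}" for x
  proof -
    define line where "line t = x + t *\<^sub>R (x1 - x)" for t :: real
    have "polynomial_function line"
      unfolding line_def
      by (intro polynomial_function_add polynomial_function_const polynomial_function_mult)
         (auto simp: polynomial_function_id)
    then have "real_polynomial_function (g \<circ> line)" using g by (rule real_polynomial_function_compose)
    then obtain a n where a: "g \<circ> line = (\<lambda>t. \<Sum>i\<le>n. a i * t ^ i)"
      by (auto simp: real_polynomial_function_iff_sum)
    have "(g \<circ> line) 1 \<noteq> 0" using x1 by (simp add: line_def)
    then have "\<exists>i\<le>n. a i \<noteq> 0" unfolding a by (auto intro: ccontr sum.neutral)
    then have fin: "finite {t. (\<Sum>i\<le>n. a i * t ^ i) = 0}" by (simp add: polyfun_finite_roots)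
    then have "\<forall>\<^sub>F t in at 0. (\<Sum>i\<le>n. a i * t ^ i) \<noteq> 0"
      using islimpt_finite[OF fin, of 0] by (simp add: islimpt_iff_eventually)
    then have "\<forall>\<^sub>F t in at 0. line t \<in> {x. g x \<noteq> 0}"
      by eventually_elim (use a in \<open>auto simp: fun_eq_iff\<close>)
    moreover have "(line \<longlongrightarrow> x) (at 0)"
      unfolding line_def by (auto intro!: tendsto_eq_intros)
    ultimately show ?thesis
      by (intro Lim_in_closed_set[OF closed_closure])
        (auto elim!: eventually_mono intro: closure_subset[THEN subsetD])
  qed
  then show ?thesis by auto
qed

text \<open>The differentials at \<open>t x\<^sub>0\<close>, divided by \<open>t\<close>, tend to the second derivatives as
  \<open>t\<close> tends to \<open>0\<close>, so they are independent at one point, hence wherever a certain nonzero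
  polynomial does not vanish.\<close>

lemma functionally_independent_of_jets:
  fixes f :: "'i \<Rightarrow> 'a::euclidean_space \<Rightarrow> complex"
  assumes I: "finite I"
    and jet: "\<And>i. i \<in> I \<Longrightarrow> has_jet (f i) (c i) (Q i)"
    and indep: "indep_funs I (\<lambda>i v. Re (Q i x0 v))"
  shows "\<exists>U. open U \<and> closure U = UNIV \<and>
    (\<forall>x\<in>U. functionally_independent_at I (\<lambda>i x. Re (f i x)) x)"
proof -
  obtain D where
    D: "\<And>i x. i \<in> I \<Longrightarrow> (f i has_derivative D i x) (at x)"
    and poly: "\<And>i v. i \<in> I \<Longrightarrow> cpoly (\<lambda>x. D i x v)"
    and lim: "\<And>i x v. i \<in> I \<Longrightarrow> ((\<lambda>t. D i (t *\<^sub>R x) v /\<^sub>R t) \<longlongrightarrow> Q i x v) (at 0)"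
  proof -
    have "\<forall>i\<in>I. \<exists>D. (\<forall>x. (f i has_derivative D x) (at x)) \<and> (\<forall>v. cpoly (\<lambda>x. D x v)) \<and>
       (\<forall>x v. ((\<lambda>t. D (t *\<^sub>R x) v /\<^sub>R t) \<longlongrightarrow> Q i x v) (at 0))"
      using jet unfolding has_jet_def by blast
    from bchoice[OF this] show ?thesis using that by blast
  qed
  define F where "F x i v = Re (D i x v)" for x i v
  \<comment> \<open>The differentials at \<open>t *\<^sub>R x0\<close> divided by \<open>t\<close>,
    extended to \<open>t = 0\<close> by the second derivatives; the extension is continuous at 0.
    Elimination among functions continuous at 0 then gives independence for small
    \<open>t \<noteq> 0\<close>.\<close>
  define H where "H t i v = (if t = 0 then Re (Q i x0 v) else F (t *\<^sub>R x0) i v / t)" for t i v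
  have "H 0 = (\<lambda>i v. Re (Q i x0 v))" by (simp add: H_def fun_eq_iff)
  with indep have "indep_funs I (H 0)" by simp
  moreover have "(\<lambda>t. H t i v) \<in> {g. isCont g 0}" if "i \<in> I" for i v
  proof -
    have "((\<lambda>t. Re (D i (t *\<^sub>R x0) v /\<^sub>R t)) \<longlongrightarrow> Re (Q i x0 v)) (at 0)"
      by (intro tendsto_Re lim that)
    then have "((\<lambda>t. H t i v) \<longlongrightarrow> Re (Q i x0 v)) (at 0)"
      by (rule Lim_transform_eventually)
        (auto simp: H_def F_def eventually_at_filter divide_inverse mult.commute)
    then show ?thesis by (simp add: isCont_def H_def)
  qed
  ultimately obtain g where g: "isCont g 0" "g 0 \<noteq> (0::real)" "\<And>t. g t \<noteq> 0 \<Longrightarrow> indep_funs I (H t)"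
    using indep_funs_generic[OF I, of "{g. isCont g 0}" H "0::real"] by auto
  have "\<forall>\<^sub>F t in at 0. g t \<noteq> 0"
    using g by (intro tendsto_imp_eventually_ne[of _ "g 0"]) (simp_all add: isCont_def)
  then have "\<forall>\<^sub>F t in at 0. g t \<noteq> 0 \<and> t \<noteq> 0"
    using eventually_neq_at_within by (rule eventually_conj)
  then obtain t where t: "g t \<noteq> 0" "t \<noteq> 0"
    using eventually_happens[of _ "at (0::real)"] by auto
  define x1 where "x1 = t *\<^sub>R x0"
  have "indep_funs I (F x1)"
    unfolding indep_funs_def
  proof (intro allI impI)
    fix a assume a: "\<forall>v. (\<Sum>i\<in>I. a i * F x1 i v) = 0"
    have "(\<Sum>i\<in>I. a i * H t i v) = (\<Sum>i\<in>I. a i * F x1 i v) / t" for v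
      using t by (simp add: H_def x1_def sum_divide_distrib)
    with a g(3)[OF t(1)] show "\<forall>i\<in>I. a i = 0" unfolding indep_funs_def by simp
  qed
  moreover have "(\<lambda>x. F x i v) \<in> Collect real_polynomial_function" if "i \<in> I" for i v
    using poly[OF that] by (simp add: F_def cpoly_def)
  \<comment> \<open>Second use of the elimination, now with polynomial entries: independence at
    \<open>x1\<close> spreads to the non-zero set of the polynomial \<open>p\<close>.\<close>
  ultimately obtain p where p: "real_polynomial_function p" "p x1 \<noteq> 0"
    "\<And>x. p x \<noteq> 0 \<Longrightarrow> indep_funs I (F x)"
    using indep_funs_generic[OF I, of "Collect real_polynomial_function" F x1] by auto
  have "open {x. p x \<noteq> 0}"
  proof -
    have "continuous_on UNIV p"
      using p(1) by (simp add: continuous_at_imp_continuous_on continuous_real_polymonial_function)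
    then have "open (p -` (- {0}))" by (rule open_vimage[OF _, rotated]) auto
    then show ?thesis by (simp add: vimage_def)
  qed
  moreover have "functionally_independent_at I (\<lambda>i x. Re (f i x)) x" if x: "p x \<noteq> 0" for x
  proof -
    have der: "((\<lambda>x. Re (f i x)) has_derivative F x i) (at x)" if "i \<in> I" for i
      unfolding F_def[abs_def] using D[OF that] by (rule has_derivative_Re)
    have app: "blinfun_apply (Blinfun (F x i)) = F x i" if "i \<in> I" for i
      using der[OF that] by (intro bounded_linear_Blinfun_apply has_derivative_bounded_linear)
    have "independent_family I (\<lambda>i. Blinfun (F x i))"
    proof (rule independent_familyI[OF I])
      fix a assume "(\<Sum>i\<in>I. a i *\<^sub>R Blinfun (F x i)) = 0"
      then have "blinfun_apply (\<Sum>i\<in>I. a i *\<^sub>R Blinfun (F x i)) v = 0" for v by simp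
      then have "\<forall>v. (\<Sum>i\<in>I. a i * F x i v) = 0"
        by (simp add: blinfun.sum_left blinfun.scaleR_left app)
      with p(3)[OF x] show "\<forall>i\<in>I. a i = 0" unfolding indep_funs_def by simp
    qed
    then show ?thesis
      unfolding functionally_independent_at_def
      by (intro exI[of _ "\<lambda>i. Blinfun (F x i)"]) (simp add: app der)
  qed
  ultimately show ?thesis
    using closure_nonzero_polynomial[OF p(1,2)] by (intro exI[of _ "{x. p x \<noteq> 0}"]) auto
qed

text \<open>The functionals are the differentials of the quadratic parts at a point with equal
  columns. Testing one coordinate of one column and using the independence of \<open>s\<close>
  isolates \<open>k\<close>; what remains is a polynomial of degree below \<open>CARD('r)\<close>
  with the \<open>CARD('r)\<close> distinct roots \<open>l \<sigma> ^ m\<close>.\<close>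

lemma indep_funs_vandermonde:
  fixes l :: "'r::finite \<Rightarrow> real" and s :: "nat \<Rightarrow> 'm::finite \<Rightarrow> real"
  assumes s: "indep_funs {1..n} s" and l: "\<And>\<sigma>. l \<sigma> \<noteq> 0" "inj (\<lambda>\<sigma>. l \<sigma> ^ m)"
    and C: "C \<noteq> 0"
  shows "indep_funs ({1..n} \<times> {1..CARD('r)})
    (\<lambda>(k, p) (v :: real^'m^'r). C * (\<Sum>\<sigma>\<in>UNIV. l \<sigma> ^ (m * (p - 1) + e k) * (\<Sum>i\<in>UNIV. s k i * v $ \<sigma> $ i)))"
  unfolding indep_funs_def
proof (intro allI impI)
  let ?I = "{1..n} \<times> {1..CARD('r)}"
  fix a :: "nat \<times> nat \<Rightarrow> real"
  assume a: "\<forall>v. (\<Sum>x\<in>?I. a x * (case x of (k, p) \<Rightarrow> \<lambda>v :: real^'m^'r.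
    C * (\<Sum>\<sigma>\<in>UNIV. l \<sigma> ^ (m * (p - 1) + e k) * (\<Sum>i\<in>UNIV. s k i * v $ \<sigma> $ i))) v) = 0"
  have row: "(\<Sum>p\<in>{1..CARD('r)}. a (k, p) * l \<sigma> ^ (m * (p - 1) + e k)) = 0" if k: "k \<in> {1..n}" for k \<sigma>
  proof -
    have "(\<Sum>k\<in>{1..n}. (\<Sum>p\<in>{1..CARD('r)}. a (k, p) * l \<sigma> ^ (m * (p - 1) + e k)) * s k i) = 0" for i
    proof -
      \<comment> \<open>This direction moves only the coordinate \<open>i\<close> of the column
        \<sigma>.\<close>
      let ?v = "axis \<sigma> (axis i 1) :: real^'m^'r"
      have v: "?v $ \<tau> $ j = (if \<tau> = \<sigma> \<and> j = i then 1 else 0)" for \<tau> j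
        by (simp add: axis_def)
      have inner: "(\<Sum>j\<in>UNIV. s k j * ?v $ \<tau> $ j) = (if \<tau> = \<sigma> then s k i else 0)" for k \<tau>
        unfolding v by (cases "\<tau> = \<sigma>") (simp_all add: if_distrib cong: if_cong)
      have "(\<Sum>\<tau>\<in>UNIV. l \<tau> ^ d * (\<Sum>j\<in>UNIV. s k j * ?v $ \<tau> $ j)) = l \<sigma> ^ d * s k i" for k d
        unfolding inner by (simp add: if_distrib cong: if_cong)
      then have "(\<Sum>(k, p)\<in>?I. a (k, p) * (C * (l \<sigma> ^ (m * (p - 1) + e k) * s k i))) = 0"
        using a[rule_format, of ?v] by (simp add: case_prod_beta)
      then have "C * (\<Sum>k\<in>{1..n}. (\<Sum>p\<in>{1..CARD('r)}. a (k, p) * l \<sigma> ^ (m * (p - 1) + e k)) * s k i) = 0"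
        by (simp add: sum.cartesian_product[symmetric] sum_distrib_left sum_distrib_right mult_ac)
      with C show ?thesis by simp
    qed
    then show ?thesis
      using s[unfolded indep_funs_def, rule_format, of "\<lambda>k. \<Sum>p\<in>{1..CARD('r)}. a (k, p) * l \<sigma> ^ (m * (p - 1) + e k)" k] k
      by blast
  qed
  have "a (k, p) = 0" if k: "k \<in> {1..n}" and p: "p \<in> {1..CARD('r)}" for k p
  proof -
    \<comment> \<open>The index is shifted by \<open>p = Suc j\<close>. The common factor
      \<open>l \<sigma> ^ e k\<close> is non-zero and can be cancelled from the relation.\<close>
    define P where "P = (\<Sum>j<CARD('r). Polynomial.monom (a (k, Suc j)) j)"
    have root: "poly P (l \<sigma> ^ m) = 0" for \<sigma>
    proof -
      have "(\<Sum>p\<in>{1..CARD('r)}. a (k, p) * l \<sigma> ^ (m * (p - 1) + e k)) = 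
          (\<Sum>j<CARD('r). a (k, Suc j) * l \<sigma> ^ (m * j + e k))"
        by (rule sum.reindex_bij_witness[of _ Suc "\<lambda>p. p - 1"]) auto
      also have "\<dots> = (\<Sum>j<CARD('r). l \<sigma> ^ e k * (a (k, Suc j) * (l \<sigma> ^ m) ^ j))"
        by (intro sum.cong refl) (simp add: power_add power_mult)
      also have "\<dots> = l \<sigma> ^ e k * poly P (l \<sigma> ^ m)"
        by (simp add: P_def poly_sum poly_monom sum_distrib_left)
      finally show ?thesis using row[OF k, of \<sigma>] l(1) by simp
    qed
    have coeff: "poly.coeff P j = (if j < CARD('r) then a (k, Suc j) else 0)" for j
      by (simp add: P_def coeff_sum)
    have "P = 0"
    proof (rule ccontr)
      assume "P \<noteq> 0"
      have "Polynomial.degree P < CARD('r)"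
        by (rule degree_lessI) (auto simp: coeff \<open>P \<noteq> 0\<close>)
      moreover have "CARD('r) \<le> card {x. poly P x = 0}"
      proof -
        have "CARD('r) = card (range (\<lambda>\<sigma>. l \<sigma> ^ m))" using l(2) by (simp add: card_image)
        also have "\<dots> \<le> card {x. poly P x = 0}"
          using root poly_roots_finite[OF \<open>P \<noteq> 0\<close>] by (intro card_mono) auto
        finally show ?thesis .
      qed
      ultimately show False using card_poly_roots_bound[OF \<open>P \<noteq> 0\<close>] by simp
    qed
    then have "poly.coeff P (p - 1) = 0" by simp
    with p show ?thesis by (auto simp: coeff split: if_splits)
  qed
  then show "\<forall>x\<in>?I. a x = 0" by auto
qed

subsection \<open>Matrices\<close>

lemma cscale_mult_left: "cscale c A ** B = cscale c (A ** B)"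
  by (simp add: vec_eq_iff matrix_matrix_mult_def sum_distrib_left mult.assoc)

lemma cscale_mult_right: "A ** cscale c B = cscale c (A ** B)"
  by (simp add: vec_eq_iff matrix_matrix_mult_def sum_distrib_left mult.left_commute)

lemma cscale_cscale: "cscale a (cscale b X) = cscale (a * b) X"
  by (simp add: vec_eq_iff mult.assoc)

lemma cscale_1: "cscale 1 X = X"
  by (simp add: vec_eq_iff)

lemma cscale_vector_mult: "cscale c A *v x = c *s (A *v x)"
  by (simp add: vec_eq_iff matrix_vector_mult_def sum_distrib_left mult.assoc)

lemma trace_cscale: "trace (cscale c A) = c * trace A"
  by (simp add: trace_def sum_distrib_left)

lemma cscale_cancel: "c \<noteq> 0 \<Longrightarrow> cscale c A = cscale c B \<longleftrightarrow> A = B"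
  by (auto simp: vec_eq_iff)

lemma map_matrix_mult:
  fixes A :: "'a::semiring_1^'n^'m" and f :: "'a \<Rightarrow> 'b::semiring_1"
  assumes "\<And>x y. f (x + y) = f x + f y" "\<And>x y. f (x * y) = f x * f y" "f 0 = 0"
  shows "map_matrix f (A ** B) = map_matrix f A ** map_matrix f B"
proof -
  have "f (sum g I) = (\<Sum>i\<in>I. f (g i))" if "finite I" for g :: "'n \<Rightarrow> 'a" and I
    using that by (induction I rule: finite_induct) (simp_all add: assms)
  then show ?thesis by (simp add: vec_eq_iff matrix_matrix_mult_def assms)
qed

lemma conj_mat_mult: "conj_mat (A ** B) = conj_mat A ** conj_mat B"
  by (rule map_matrix_mult) auto

lemma cmat_mult: "cmat (A ** B) = cmat A ** cmat B"
  by (rule map_matrix_mult) auto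

lemma map_matrix_mat_1: "f 0 = 0 \<Longrightarrow> f 1 = 1 \<Longrightarrow> map_matrix f (mat 1) = mat 1"
  by (simp add: vec_eq_iff mat_def)

lemma conj_mat_power: "conj_mat (mat_power A k) = mat_power (conj_mat A) k"
  by (induction k) (simp_all add: conj_mat_mult map_matrix_mat_1)

lemma mat_power_commute:
  assumes "A ** B = B ** A"
  shows "mat_power A k ** B = B ** mat_power A k"
proof (induction k)
  case (Suc k)
  have "mat_power A (Suc k) ** B = A ** (mat_power A k ** B)"
    by (simp add: matrix_mul_assoc)
  also have "\<dots> = B ** mat_power A (Suc k)"
    by (simp add: Suc assms matrix_mul_assoc)
  finally show ?case .
qed simp

lemma mat_power_Suc_right: "mat_power A (Suc k) = mat_power A k ** A"
  using mat_power_commute[of A A k] by simp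

lemma mat_power_add: "mat_power A (j + k) = mat_power A j ** mat_power A k"
  by (induction j) (simp_all add: matrix_mul_assoc)

lemma mat_power_eigenvector:
  assumes "A *v x = \<mu> *s x"
  shows "mat_power A k *v x = \<mu> ^ k *s x"
proof (induction k)
  case (Suc k)
  have "mat_power A (Suc k) *v x = A *v (mat_power A k *v x)"
    by (simp add: matrix_vector_mul_assoc)
  then show ?case by (simp add: Suc vec.scale assms mult.commute)
qed simp

lemma matrix_inv_unique:
  fixes A B :: "'a::field^'n^'n"
  assumes "A ** B = mat 1"
  shows "matrix_inv A = B"
proof -
  have "B ** A = mat 1" using assms by (simp add: matrix_left_right_inverse)
  with assms have "A ** matrix_inv A = mat 1"
    unfolding matrix_inv_def by (metis (mono_tags, lifting) someI)
  then show ?thesis using \<open>B ** A = mat 1\<close> by (metis matrix_mul_assoc matrix_mul_lid matrix_mul_rid)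
qed

lemma invertible_matrix_inv:
  fixes A :: "'a::field^'n^'n"
  assumes "invertible A"
  shows "A ** matrix_inv A = mat 1" "matrix_inv A ** A = mat 1"
  using assms matrix_inv_unique unfolding invertible_def by metis+

subsection \<open>Joint eigenvectors and separating vectors\<close>

definition joint_eigenvectors :: "('a::field^'m^'m) set \<Rightarrow> ('a^'m) set" where
  "joint_eigenvectors S = {x. \<forall>A\<in>S. \<exists>\<mu>. A *v x = \<mu> *s x}"

text \<open>The columns of the diagonalizing matrix \<open>P\<close> are eigenvectors, and they span
  because \<open>P\<close> is invertible.\<close>

lemma span_eigenvectors_diagonalizable:
  fixes K :: "complex^'m^'m"
  assumes "mat_diagonalizable K"
  shows "vec.span (joint_eigenvectors {K}) = UNIV"
proof -
  obtain P D :: "complex^'m^'m" where P: "invertible P" and D: "\<And>i j. i \<noteq> j \<Longrightarrow> D $ i $ j = 0"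
    and K: "K = P ** D ** matrix_inv P"
    using assms unfolding mat_diagonalizable_def by blast
  note inv = invertible_matrix_inv[OF P]
  have KP: "K ** P = P ** D" unfolding K by (metis inv(2) matrix_mul_assoc matrix_mul_rid)
  have col: "column j P \<in> joint_eigenvectors {K}" for j
  proof -
    have "(K ** P) $ i $ j = P $ i $ j * D $ j $ j" for i
    proof -
      have "(P ** D) $ i $ j = (\<Sum>k\<in>UNIV. if k = j then P $ i $ j * D $ j $ j else 0)"
        by (simp only: matrix_matrix_mult_def vec_lambda_beta) (intro sum.cong, auto simp: D)
      then show ?thesis using KP by simp
    qed
    then have "K *v column j P = D $ j $ j *s column j P"
      by (simp add: vec_eq_iff column_def matrix_vector_mult_def matrix_matrix_mult_def mult.commute)
    then show ?thesis by (auto simp: joint_eigenvectors_def)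
  qed
  have "x \<in> vec.span (joint_eigenvectors {K})" for x
  proof -
    have "x = P *v (matrix_inv P *v x)" by (simp add: matrix_vector_mul_assoc inv)
    also have "\<dots> = (\<Sum>j\<in>UNIV. (matrix_inv P *v x) $ j *s column j P)" by (rule matrix_mult_sum)
    also have "\<dots> \<in> vec.span (joint_eigenvectors {K})"
      by (intro vec.span_sum vec.span_scale vec.span_base col)
    finally show ?thesis .
  qed
  then show ?thesis by auto
qed

text \<open>A matrix \<open>g\<close> of finite order \<open>M\<close> refines eigenspaces by means of the averages
  \<open>\<Sum>j. \<zeta>\<^sup>j g\<^sup>j x\<close> over the \<open>M\<close>-th roots of unity \<open>\<zeta>\<close>.\<close>

lemma span_joint_eigenvectors_insert:
  fixes S :: "(complex^'m^'m) set"
  assumes span: "vec.span (joint_eigenvectors S) = UNIV"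
    and M: "M > 0" "mat_power g M = mat 1"
    and comm: "\<And>A. A \<in> S \<Longrightarrow> A ** g = g ** A"
  shows "vec.span (joint_eigenvectors (insert g S)) = UNIV"
proof -
  define \<xi> where "\<xi> = exp (2 * of_real pi * \<i> * of_nat 1 / of_nat M)"
  have \<xi>M: "\<xi> ^ M = 1" using M complex_root_unity[of M 1] by (simp add: \<xi>_def)
  have \<xi>_pow: "(\<xi> ^ j) ^ M = 1" for j
    by (metis \<xi>M mult.commute power_mult power_one)
  have \<xi>_ne: "\<xi> ^ j \<noteq> 1" if "0 < j" "j < M" for j
  proof
    assume "\<xi> ^ j = 1"
    then have "exp (2 * of_real pi * \<i> * of_nat j / of_nat M) = (1::complex)"
      unfolding \<xi>_def exp_of_nat_mult[symmetric] by (simp add: mult.commute)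
    then have "M dvd j" using complex_root_unity_eq_1[of M j] M by simp
    with that show False by (auto dest: dvd_imp_le)
  qed
  have "x \<in> vec.span (joint_eigenvectors (insert g S))" if x: "x \<in> joint_eigenvectors S" for x
  proof -
    \<comment> \<open>Up to the factor \<open>M\<close>, this is the component of \<open>x\<close>
      in the eigenspace of \<open>g\<close> for the eigenvalue \<open>1 / \<xi> ^ m\<close>.\<close>
    define e where "e m = (\<Sum>j<M. (\<xi> ^ m) ^ j *s (mat_power g j *v x))" for m
    have e: "e m \<in> joint_eigenvectors (insert g S)" for m
    proof -
      define \<zeta> where "\<zeta> = \<xi> ^ m"
      have \<zeta>: "\<zeta> \<noteq> 0" "\<zeta> ^ M = 1"
        unfolding \<zeta>_def using \<xi>_pow[of m] by (simp_all add: \<xi>_def)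
      let ?y = "\<lambda>j. \<zeta> ^ j *s (mat_power g j *v x)"
      have "g *v e m = (\<Sum>j<M. (1 / \<zeta>) *s ?y (Suc j))"
        using \<zeta> by (simp add: e_def vec.sum vec.scale matrix_vector_mul_assoc flip: \<zeta>_def)
      also have "\<dots> = (1 / \<zeta>) *s (\<Sum>j<M. ?y (Suc j))"
        by (rule vec.scale_sum_right[symmetric])
      \<comment> \<open>The shift by one is cyclic: the term at \<open>M\<close> equals the term at
        0, since both \<zeta> and \<open>g\<close> have \<open>M\<close>-th power 1.\<close>
      also have "(\<Sum>j<M. ?y (Suc j)) = (\<Sum>j<M. ?y j) + ?y M - ?y 0"
        using sum.lessThan_Suc_shift[of ?y M] sum.lessThan_Suc[of ?y M] by simp
      also have "\<dots> = e m" using \<zeta> M by (simp add: e_def \<zeta>_def)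
      finally have "g *v e m = (1 / \<zeta>) *s e m" .
      moreover have "\<exists>\<mu>. A *v e m = \<mu> *s e m" if A: "A \<in> S" for A
      proof -
        obtain \<mu> where \<mu>: "A *v x = \<mu> *s x" using x A by (auto simp: joint_eigenvectors_def)
        have "A *v (mat_power g j *v x) = \<mu> *s (mat_power g j *v x)" for j
        proof -
          have "A *v (mat_power g j *v x) = mat_power g j *v (A *v x)"
            using mat_power_commute[of g A j] comm[OF A] by (simp add: matrix_vector_mul_assoc)
          then show ?thesis by (simp add: \<mu> vec.scale)
        qed
        then have "A *v e m = \<mu> *s e m"
          by (simp add: e_def vec.sum vec.scale vec.scale_sum_right mult.commute)
        then show ?thesis ..
      qed
      ultimately show ?thesis by (auto simp: joint_eigenvectors_def)
    qed
    \<comment> \<open>Orthogonality of roots of unity: the inner sum over \<open>m\<close> vanishes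
      unless \<open>j = 0\<close>, so the components add up to a multiple of
      \<open>x\<close>.\<close>
    have "(\<Sum>m<M. e m) = (\<Sum>j<M. (\<Sum>m<M. (\<xi> ^ j) ^ m) *s (mat_power g j *v x))"
      unfolding e_def by (subst sum.swap) (simp add: vec.scale_sum_left power_mult[symmetric] mult.commute)
    also have "\<dots> = (\<Sum>j<M. if j = 0 then of_nat M *s x else 0)"
    proof (intro sum.cong refl)
      fix j assume j: "j \<in> {..<M}"
      show "(\<Sum>m<M. (\<xi> ^ j) ^ m) *s (mat_power g j *v x) = (if j = 0 then of_nat M *s x else 0)"
      proof (cases "j = 0")
        case False
        then have "\<xi> ^ j \<noteq> 1" using \<xi>_ne j by auto
        then have "(\<Sum>m<M. (\<xi> ^ j) ^ m) = 0"
          by (simp add: geometric_sum \<xi>_pow)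
        then show ?thesis using False by simp
      qed simp
    qed
    also have "\<dots> = of_nat M *s x" using M by simp
    finally have "x = (1 / of_nat M) *s (\<Sum>m<M. e m)" using M by simp
    also have "\<dots> \<in> vec.span (joint_eigenvectors (insert g S))"
      by (intro vec.span_sum vec.span_scale vec.span_base e)
    finally show ?thesis .
  qed
  then have "vec.span (joint_eigenvectors S) \<subseteq> vec.span (joint_eigenvectors (insert g S))"
    by (intro vec.span_minimal) auto
  with span show ?thesis by auto
qed

text \<open>Eigenvectors of \<open>K\<close> are refined by one commuting matrix of finite order at
  a time.\<close>

lemma span_joint_eigenvectors:
  fixes H :: "(complex^'m^'m) set"
  assumes "mat_diagonalizable K" "finite H"
    and "\<And>g. g \<in> H \<Longrightarrow> \<exists>M>0. mat_power g M = mat 1"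
    and "\<And>g. g \<in> H \<Longrightarrow> K ** g = g ** K"
    and "\<And>g g'. g \<in> H \<Longrightarrow> g' \<in> H \<Longrightarrow> g ** g' = g' ** g"
  shows "vec.span (joint_eigenvectors (insert K H)) = UNIV"
  using assms(2-)
proof (induction H rule: finite_induct)
  case empty
  then show ?case using span_eigenvectors_diagonalizable[OF assms(1)] by simp
next
  case (insert g H)
  then obtain M where "M > 0" "mat_power g M = mat 1" by blast
  with insert have "vec.span (joint_eigenvectors (insert g (insert K H))) = UNIV"
    by (intro span_joint_eigenvectors_insert[where S = "insert K H"]) auto
  then show ?case by (simp add: insert_commute)
qed

text \<open>The sum of a basis of joint eigenvectors is a separating vector.\<close>

lemma exists_separating_vector:
  fixes T :: "'i \<Rightarrow> 'a::field^'m^'m"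
  assumes span: "vec.span (joint_eigenvectors S) = UNIV" and I: "finite I"
    and eig: "\<And>j x. j \<in> I \<Longrightarrow> x \<in> joint_eigenvectors S \<Longrightarrow> \<exists>\<mu>. T j *v x = \<mu> *s x"
    and indep: "indep_funs I (\<lambda>j (p, q). T j $ p $ q)"
  shows "\<exists>v. indep_funs I (\<lambda>j p. (T j *v v) $ p)"
proof -
  obtain B where B: "B \<subseteq> joint_eigenvectors S" "vec.independent B"
     "joint_eigenvectors S \<subseteq> vec.span B"
    using vec.maximal_independent_subset by blast
  have spanB: "vec.span B = UNIV"
    using vec.span_minimal[OF B(3) vec.subspace_span] span by auto
  have finB: "finite B" using B(2) by (rule vec.finiteI_independent)
  obtain \<tau> where \<tau>: "\<And>j b. j \<in> I \<Longrightarrow> b \<in> B \<Longrightarrow> T j *v b = \<tau> j b *s b"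
    using eig B(1) by (metis subset_iff)
  \<comment> \<open>All coordinates of \<open>v\<close> in the basis \<open>B\<close> are 1, so a
    relation among the \<open>T j *v v\<close> forces the same relation among the eigenvalues at
    every \<open>b\<close>.\<close>
  define v where "v = (\<Sum>b\<in>B. b)"
  have "indep_funs I (\<lambda>j p. (T j *v v) $ p)"
    unfolding indep_funs_def
  proof (intro allI impI)
    fix a assume "\<forall>p. (\<Sum>j\<in>I. a j * (T j *v v) $ p) = 0"
    then have "0 = (\<Sum>j\<in>I. a j *s (T j *v v))" by (simp add: vec_eq_iff)
    also have "\<dots> = (\<Sum>j\<in>I. \<Sum>b\<in>B. (a j * \<tau> j b) *s b)"
      by (intro sum.cong) (simp_all add: v_def vec.sum \<tau> vec.scale_sum_right)
    also have "\<dots> = (\<Sum>b\<in>B. (\<Sum>j\<in>I. a j * \<tau> j b) *s b)"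
      by (subst sum.swap) (simp add: vec.scale_sum_left)
    finally have combination: "(\<Sum>b\<in>B. (\<Sum>j\<in>I. a j * \<tau> j b) *s b) = 0" ..
    have zero: "(\<Sum>j\<in>I. a j * \<tau> j b) = 0" if "b \<in> B" for b
    proof (rule ccontr)
      assume "(\<Sum>j\<in>I. a j * \<tau> j b) \<noteq> 0"
      with combination that have "vec.dependent B"
        unfolding vec.dependent_finite[OF finB]
        by (intro exI[of _ "\<lambda>b. \<Sum>j\<in>I. a j * \<tau> j b"]) blast
      with B(2) show False by simp
    qed
    \<comment> \<open>The corresponding combination of the matrices themselves. It kills the basis
      \<open>B\<close>, hence is zero, and the independence of the \<open>T j\<close>
      applies.\<close>
    define R where "R = (\<Sum>j\<in>I. (\<chi> p q. a j * T j $ p $ q))"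
    have R: "R *v x = (\<Sum>j\<in>I. a j *s (T j *v x))" for x
    proof -
      have "R *v x = (\<Sum>j\<in>I. (\<chi> p q. a j * T j $ p $ q) *v x)"
        unfolding R_def using I
        by (induction I rule: finite_induct) (simp_all add: matrix_vector_mult_add_rdistrib)
      also have "\<dots> = (\<Sum>j\<in>I. a j *s (T j *v x))"
        by (intro sum.cong) (simp_all add: vec_eq_iff matrix_vector_mult_def sum_distrib_left mult.assoc)
      finally show ?thesis .
    qed
    have R_B: "R *v b = 0" if "b \<in> B" for b
    proof -
      have "R *v b = (\<Sum>j\<in>I. a j * \<tau> j b) *s b"
        unfolding R by (simp add: \<tau> that vec.scale_sum_left)
      then show ?thesis using zero[OF that] by simp
    qed
    have "R *v x = 0" if "x \<in> vec.span B" for x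
      using that by (induction rule: vec.span_induct_alt) (simp_all add: R_B vec.add vec.scale)
    then have "R *v x = 0 *v x" for x using spanB by simp
    then have "R = 0" by (simp add: matrix_eq)
    then have "\<forall>u. (\<Sum>j\<in>I. a j * (case u of (p, q) \<Rightarrow> T j $ p $ q)) = 0"
      by (simp add: R_def vec_eq_iff split: prod.splits)
    then show "\<forall>j\<in>I. a j = 0" using indep unfolding indep_funs_def by blast
  qed
  then show ?thesis ..
qed

text \<open>On the complex line through the real and imaginary parts of a complex separating vector,
  all but finitely many points are separating.\<close>

lemma exists_real_separating_vector:
  fixes T :: "'i \<Rightarrow> complex^'m^'m"
  assumes I: "finite I" and v: "indep_funs I (\<lambda>j p. (T j *v v) $ p)"
  shows "\<exists>u :: real^'m. indep_funs I (\<lambda>j p. (T j *v (\<chi> i. of_real (u $ i))) $ p)"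
proof -
  define x y where "x = (\<chi> i. complex_of_real (Re (v $ i)))" and "y = (\<chi> i. complex_of_real (Im (v $ i)))"
  \<comment> \<open>\<open>F s\<close> is the family at \<open>x + s *s y\<close>: its entries are
    affine in \<open>s\<close>, and \<open>s = \<i>\<close> recovers \<open>v\<close>.\<close>
  define F where "F s j p = (T j *v x) $ p + s * (T j *v y) $ p" for s j p
  have F: "F s = (\<lambda>j p. (T j *v (x + s *s y)) $ p)" for s
    by (simp add: fun_eq_iff F_def matrix_vector_right_distrib vec.scale)
  have "v = x + \<i> *s y" by (simp add: x_def y_def vec_eq_iff complex_eq)
  with v have "indep_funs I (F \<i>)" by (simp add: F)
  moreover have "(\<lambda>s. F s j p) \<in> range poly" for j p
    unfolding F_def
    by (rule image_eqI[of _ _ "[:(T j *v x) $ p, (T j *v y) $ p:]"]) (simp_all add: fun_eq_iff)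
  moreover have "(\<lambda>s. f s * g s) \<in> range poly" "(\<lambda>s. f s - g s) \<in> range poly"
    if "f \<in> range poly" "g \<in> range poly" for f g :: "complex \<Rightarrow> complex"
    using that by (auto simp flip: poly_mult poly_diff)
  moreover have "(\<lambda>s. 1) \<in> range (poly :: complex poly \<Rightarrow> _)"
    by (rule image_eqI[of _ _ 1]) (simp_all add: fun_eq_iff)
  ultimately obtain q where q: "poly q \<i> \<noteq> 0" "\<And>s. poly q s \<noteq> 0 \<Longrightarrow> indep_funs I (F s)"
    using indep_funs_generic[OF I, of "range poly" F \<i>] by blast
  then have "finite {s. poly q s = 0}" by (intro poly_roots_finite) auto
  then have "finite (of_real -` {s. poly q s = 0} :: real set)"
    by (intro finite_vimageI) (auto simp: inj_def)
  then obtain s :: real where "poly q (of_real s) \<noteq> 0"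
    using infinite_UNIV_char_0[where 'a = real] by (metis (mono_tags, lifting) finite_subset mem_Collect_eq subsetI vimageI)
  then have "indep_funs I (F (of_real s))" by (rule q)
  moreover have "x + of_real s *s y = (\<chi> i. of_real ((\<chi> i. Re (v $ i) + s * Im (v $ i)) $ i))"
    by (simp add: x_def y_def vec_eq_iff)
  ultimately show ?thesis unfolding F by metis
qed

subsection \<open>The symplectic group modulo sign\<close>

lemma sp_group_simps:
  "A \<in> carrier (sp_group W) \<longleftrightarrow> invertible A \<and> transpose A ** cmat W ** A = cmat W"
  "A \<otimes>\<^bsub>sp_group W\<^esub> B = A ** B"
  "\<one>\<^bsub>sp_group W\<^esub> = mat 1"
  by (simp_all add: sp_group_def)

lemma sp_group_is_group: "group (sp_group W)"
proof (rule groupI)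
  fix A B assume A: "A \<in> carrier (sp_group W)" and B: "B \<in> carrier (sp_group W)"
  have "transpose (A ** B) ** cmat W ** (A ** B) = transpose B ** (transpose A ** cmat W ** A) ** B"
    by (simp add: matrix_transpose_mul matrix_mul_assoc)
  then show "A \<otimes>\<^bsub>sp_group W\<^esub> B \<in> carrier (sp_group W)"
    using A B by (simp add: sp_group_simps invertible_mult)
next
  fix A assume A: "A \<in> carrier (sp_group W)"
  let ?B = "matrix_inv A"
  note inv = invertible_matrix_inv[of A]
  have "transpose ?B ** (transpose A ** cmat W ** A) ** ?B = transpose (A ** ?B) ** cmat W ** (A ** ?B)"
    by (simp add: matrix_transpose_mul matrix_mul_assoc)
  then have "?B \<in> carrier (sp_group W)"
    using A inv by (auto simp: sp_group_simps transpose_mat invertible_def)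
  moreover have "?B \<otimes>\<^bsub>sp_group W\<^esub> A = \<one>\<^bsub>sp_group W\<^esub>"
    using A inv by (simp add: sp_group_simps)
  ultimately show "\<exists>B\<in>carrier (sp_group W). B \<otimes>\<^bsub>sp_group W\<^esub> A = \<one>\<^bsub>sp_group W\<^esub>" by blast
qed (auto simp: sp_group_simps matrix_mul_assoc invertible_def transpose_mat intro: exI[of _ "mat 1"])

lemma sp_group_pow: "A [^]\<^bsub>sp_group W\<lparr>carrier := C\<rparr>\<^esub> k = mat_power A k"
proof (induction k)
  case (Suc k)
  then show ?case by (simp add: sp_group_def mat_power_Suc_right del: mat_power.simps)
qed (simp add: sp_group_def)

lemma sp_group_pow': "A [^]\<^bsub>sp_group W\<^esub> k = mat_power A k"
  using sp_group_pow[where W = W and C = "carrier (sp_group W)" and A = A and k = k] by simp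

text \<open>By Lagrange, the order of the finite group \<open>G0\<close> is such an
  exponent.\<close>

lemma finite_order_mat:
  assumes "subgroup G0 (sp_group W)" "finite G0" "A \<in> G0"
  shows "\<exists>M>0. mat_power A M = mat 1"
proof -
  let ?G = "sp_group W\<lparr>carrier := G0\<rparr>"
  interpret G: group ?G
    using assms(1) sp_group_is_group by (rule subgroup.subgroup_is_group)
  have "A [^]\<^bsub>?G\<^esub> order ?G = \<one>\<^bsub>?G\<^esub>"
    using assms(3) by (intro G.pow_order_eq_1) simp
  moreover have "order ?G > 0"
    using assms(2) by (simp add: G.order_gt_0_iff_finite)
  ultimately show ?thesis
    by (auto simp: sp_group_pow sp_group_simps)
qed

lemma minus_mult_mat: "- A ** B = - (A ** B)" "A ** - B = - (A ** B)" for A :: "'a::ring_1^'n^'n"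
  by (simp_all add: vec_eq_iff matrix_matrix_mult_def sum_negf)

lemma normal_plus_minus_1: "{mat 1, - mat 1} \<lhd> sp_group W"
proof -
  interpret group "sp_group W" by (rule sp_group_is_group)
  have "subgroup {mat 1, - mat 1} (sp_group W)"
  proof (rule subgroupI)
    have "invertible (- mat 1 :: complex^'a^'a)"
      unfolding invertible_def by (intro exI[of _ "- mat 1"]) (simp add: minus_mult_mat)
    moreover have "transpose (- mat 1 :: complex^'a^'a) = - mat 1"
      by (simp add: vec_eq_iff transpose_def mat_def)
    ultimately show sub: "{mat 1, - mat 1} \<subseteq> carrier (sp_group W)"
      using one_closed by (auto simp: sp_group_simps minus_mult_mat)
    fix A assume "A \<in> {mat 1 :: complex^'a^'a, - mat 1}"
    then have "A \<otimes>\<^bsub>sp_group W\<^esub> A = \<one>\<^bsub>sp_group W\<^esub>" "A \<in> carrier (sp_group W)"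
      using sub by (auto simp: sp_group_simps minus_mult_mat)
    then have "inv\<^bsub>sp_group W\<^esub> A = A" by (intro inv_equality)
    then show "inv\<^bsub>sp_group W\<^esub> A \<in> {mat 1, - mat 1}"
      using \<open>A \<in> {mat 1, - mat 1}\<close> by simp
  qed (auto simp: sp_group_simps minus_mult_mat)
  then show ?thesis
    by (rule normalI) (auto simp: r_coset_def l_coset_def sp_group_simps minus_mult_mat)
qed

text \<open>A finite order of \<open>A\<close> bounds the order of its image, and the kernel of the
  projection consists of plus and minus the identity.\<close>

lemma pr_ord_properties:
  assumes "subgroup G0 (sp_group W)" "finite G0" "A \<in> G0"
  shows "pr_ord W A > 0" "mat_power A (pr_ord W A) \<in> {mat 1, - mat 1}"
proof -
  let ?H = "{mat 1, - mat 1} :: (complex^'a^'a) set"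
  interpret normal ?H "sp_group W" by (rule normal_plus_minus_1)
  interpret Q: group "proj_group W"
    unfolding proj_group_def by (rule factorgroup_is_group)
  interpret hom: group_hom "sp_group W" "proj_group W" "pr W"
    using r_coset_hom_Mod
    by unfold_locales (simp add: proj_group_def pr_def[abs_def])
  have A: "A \<in> carrier (sp_group W)" using assms subgroup.subset by blast
  have pow: "pr W A [^]\<^bsub>proj_group W\<^esub> k = pr W (mat_power A k)" for k :: nat
    using hom.hom_nat_pow[OF A] by (simp add: sp_group_pow')
  have one: "\<one>\<^bsub>proj_group W\<^esub> = ?H" by (simp add: proj_group_def)
  obtain M where M: "M > 0" "mat_power A M = mat 1" using finite_order_mat[OF assms] by blast
  have "pr W A [^]\<^bsub>proj_group W\<^esub> M = \<one>\<^bsub>proj_group W\<^esub>"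
    unfolding pow M one by (auto simp: pr_def r_coset_def sp_group_simps)
  \<comment> \<open>An element of infinite order would have \<open>ord\<close> equal to 0; dividing
    the positive \<open>M\<close> excludes this value.\<close>
  then have "pr_ord W A dvd M"
    using Q.pow_eq_id[OF hom.hom_closed[OF A]] by (simp add: pr_ord_def)
  with M show "pr_ord W A > 0" by (auto intro: Nat.gr0I)
  have "pr W (mat_power A (pr_ord W A)) = ?H"
    using Q.pow_ord_eq_1[OF hom.hom_closed[OF A]] pow one by (simp add: pr_ord_def)
  moreover have "mat_power A (pr_ord W A) \<in> pr W (mat_power A (pr_ord W A))"
    by (simp add: pr_def r_coset_def sp_group_simps)
  ultimately show "mat_power A (pr_ord W A) \<in> {mat 1, - mat 1}" by simp
qed

subsection \<open>The Lax matrix\<close>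

text \<open>The coefficient of \<open>1 / z ^ d\<close> in the Lax matrix at infinity. The exponent
  \<open>d - 1\<close> comes from the expansion of \<open>1 / (z - c)\<close>.\<close>

definition lax_coeff ::
  "real^'m^'m \<Rightarrow> nat \<Rightarrow> (nat \<Rightarrow> complex^'m^'m) \<Rightarrow> (complex^'m^'m \<Rightarrow> complex) \<Rightarrow>
   complex^'m^'m \<Rightarrow> real \<Rightarrow> ('r \<Rightarrow> real) \<Rightarrow> real^'m^'r::finite \<Rightarrow> nat \<Rightarrow> complex^'m^'m" where
  "lax_coeff W N \<Omega> \<omega> K \<kappa> l \<Phi> d =
     (if d = 0 then K else cscale (of_real \<kappa>)
       (\<Sum>\<alpha>\<in>Sigma0 W N \<Omega>. \<Sum>\<sigma>\<in>UNIV.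
          cscale ((omega_pow \<omega> N \<Omega> \<alpha> * of_real (l \<sigma>)) ^ (d - 1))
            (Omega_pow N \<Omega> \<alpha> ** outer (\<Phi> $ \<sigma>) ** transpose (Omega_pow N \<Omega> \<alpha>) ** cmat W)))"

lemma coeffs_at_infinity_trace_lax:
  "coeffs_at_infinity (\<lambda>z. trace (\<theta> ** mat_power (lax W N \<Omega> \<omega> K \<kappa> l \<Phi> z) k)) =
    (\<lambda>d. trace (\<theta> ** power_coeff (lax_coeff W N \<Omega> \<omega> K \<kappa> l \<Phi>) k d))"
proof -
  define \<mu> where "\<mu> \<alpha> \<sigma> = omega_pow \<omega> N \<Omega> \<alpha> * of_real (l \<sigma>)" for \<alpha> \<sigma>
  define B where "B \<alpha> \<sigma> = Omega_pow N \<Omega> \<alpha> ** outer (\<Phi> $ \<sigma>) ** transpose (Omega_pow N \<Omega> \<alpha>) ** cmat W" for \<alpha> \<sigma>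
  \<comment> \<open>The Lax matrix in the variable \<open>w = 1 / z\<close>, extended by the value
    \<open>K\<close> at \<open>w = 0\<close>.\<close>
  define M where "M w = K + cscale (of_real \<kappa>)
    (\<Sum>\<alpha>\<in>Sigma0 W N \<Omega>. \<Sum>\<sigma>\<in>UNIV. cscale (w / (1 - \<mu> \<alpha> \<sigma> * w)) (B \<alpha> \<sigma>))" for w
  let ?A = "lax_coeff W N \<Omega> \<omega> K \<kappa> l \<Phi>"
  have M: "(\<lambda>w. M w $ i $ j) has_fps_expansion Abs_fps (\<lambda>d. ?A d $ i $ j)" for i j
  proof -
    have "(\<lambda>w. K $ i $ j + of_real \<kappa> *
        (\<Sum>\<alpha>\<in>Sigma0 W N \<Omega>. \<Sum>\<sigma>\<in>UNIV. w / (1 - \<mu> \<alpha> \<sigma> * w) * B \<alpha> \<sigma> $ i $ j)) has_fps_expansion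
      fps_const (K $ i $ j) + fps_const (of_real \<kappa>) * (\<Sum>\<alpha>\<in>Sigma0 W N \<Omega>. \<Sum>\<sigma>\<in>UNIV.
         Abs_fps (\<lambda>d. if d = 0 then 0 else \<mu> \<alpha> \<sigma> ^ (d - 1)) * fps_const (B \<alpha> \<sigma> $ i $ j))"
      by (intro has_fps_expansion_add has_fps_expansion_mult has_fps_expansion_sum
          has_fps_expansion_const has_fps_expansion_geometric)
    moreover have "fps_const (K $ i $ j) + fps_const (of_real \<kappa>) * (\<Sum>\<alpha>\<in>Sigma0 W N \<Omega>. \<Sum>\<sigma>\<in>UNIV.
         Abs_fps (\<lambda>d. if d = 0 then 0 else \<mu> \<alpha> \<sigma> ^ (d - 1)) * fps_const (B \<alpha> \<sigma> $ i $ j)) =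
         Abs_fps (\<lambda>d. ?A d $ i $ j)"
      by (auto simp: fps_eq_iff lax_coeff_def fps_sum_nth \<mu>_def B_def)
    ultimately show ?thesis by (simp add: M_def)
  qed
  have fps: "(\<lambda>w. trace (\<theta> ** mat_power (M w) k)) has_fps_expansion
      Abs_fps (\<lambda>d. trace (\<theta> ** power_coeff ?A k d))"
  proof -
    have "(\<lambda>w. \<Sum>i\<in>UNIV. \<Sum>j\<in>UNIV. \<theta> $ i $ j * mat_power (M w) k $ j $ i) has_fps_expansion
       (\<Sum>i\<in>UNIV. \<Sum>j\<in>UNIV. fps_const (\<theta> $ i $ j) * Abs_fps (\<lambda>d. power_coeff ?A k d $ j $ i))"
      by (intro has_fps_expansion_mult has_fps_expansion_sum
          has_fps_expansion_const has_fps_expansion_mat_power M)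
    moreover have "(\<Sum>i\<in>UNIV. \<Sum>j\<in>UNIV. fps_const (\<theta> $ i $ j) * Abs_fps (\<lambda>d. power_coeff ?A k d $ j $ i)) =
       Abs_fps (\<lambda>d. trace (\<theta> ** power_coeff ?A k d))"
      by (simp add: fps_eq_iff fps_sum_nth trace_def matrix_matrix_mult_def)
    ultimately show ?thesis by (simp add: trace_def matrix_matrix_mult_def)
  qed
  have "M w = lax W N \<Omega> \<omega> K \<kappa> l \<Phi> (1 / w)" if "w \<noteq> 0" for w
  proof -
    have "w / (1 - c * w) = 1 / (1 / w - c)" for c using that by (simp add: field_simps)
    then show ?thesis by (simp add: M_def lax_def \<mu>_def B_def)
  qed
  then show ?thesis
    using coeffs_at_infinity_eq[OF fps] by (simp add: fun_eq_iff)
qed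

text \<open>The polarization of \<open>outer\<close>: its derivative at \<open>x\<close> in the
  direction \<open>v\<close>.\<close>

definition sym_outer :: "real^'m \<Rightarrow> real^'m \<Rightarrow> complex^'m^'m" where
  "sym_outer x v = (\<chi> i j. of_real (x $ i * v $ j + v $ i * x $ j))"

definition lax_coeff_jet ::
  "real^'m^'m \<Rightarrow> nat \<Rightarrow> (nat \<Rightarrow> complex^'m^'m) \<Rightarrow> (complex^'m^'m \<Rightarrow> complex) \<Rightarrow>
   real \<Rightarrow> ('r \<Rightarrow> real) \<Rightarrow> nat \<Rightarrow> real^'m^'r::finite \<Rightarrow> real^'m^'r \<Rightarrow> complex^'m^'m" where
  "lax_coeff_jet W N \<Omega> \<omega> \<kappa> l d \<Phi> v =
     (if d = 0 then 0 else cscale (of_real \<kappa>)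
       (\<Sum>\<alpha>\<in>Sigma0 W N \<Omega>. \<Sum>\<sigma>\<in>UNIV.
          cscale ((omega_pow \<omega> N \<Omega> \<alpha> * of_real (l \<sigma>)) ^ (d - 1))
            (Omega_pow N \<Omega> \<alpha> ** sym_outer (\<Phi> $ \<sigma>) (v $ \<sigma>) ** transpose (Omega_pow N \<Omega> \<alpha>) ** cmat W)))"

lemma has_mat_jet_outer:
  "has_mat_jet (\<lambda>\<Phi> :: real^'m^'r::finite. outer (\<Phi> $ \<sigma>)) 0 (\<lambda>\<Phi> v. sym_outer (\<Phi> $ \<sigma>) (v $ \<sigma>))"
proof -
  have "bounded_linear (\<lambda>\<Phi> :: real^'m^'r. \<Phi> $ \<sigma> $ i)" for i
    by (rule bounded_linear_compose[OF bounded_linear_vec_nth bounded_linear_vec_nth])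
  from has_jet_quadratic[OF this this] show ?thesis
    unfolding has_mat_jet_def outer_def sym_outer_def by simp
qed

lemma has_mat_jet_lax_coeff:
  "has_mat_jet (\<lambda>\<Phi>. lax_coeff W N \<Omega> \<omega> K \<kappa> l \<Phi> d) (if d = 0 then K else 0) (lax_coeff_jet W N \<Omega> \<omega> \<kappa> l d)"
proof (cases "d = 0")
  case True
  then have "(\<lambda>\<Phi>. lax_coeff W N \<Omega> \<omega> K \<kappa> l \<Phi> d) = (\<lambda>\<Phi>. K)" "lax_coeff_jet W N \<Omega> \<omega> \<kappa> l d = (\<lambda>\<Phi> v. 0)"
    by (simp_all add: fun_eq_iff lax_coeff_def lax_coeff_jet_def)
  then show ?thesis using True by (simp add: has_mat_jet_const)
next
  case False
  \<comment> \<open>Zero is rewritten into the shape that the jet rules produce as value at the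
    origin.\<close>
  have *: "(0 :: complex^'a^'a) = cscale (of_real \<kappa>) (\<Sum>\<alpha>\<in>Sigma0 W N \<Omega>. \<Sum>\<sigma>\<in>UNIV.
      cscale ((omega_pow \<omega> N \<Omega> \<alpha> * of_real (l \<sigma>)) ^ (d - 1))
        (Omega_pow N \<Omega> \<alpha> ** 0 ** transpose (Omega_pow N \<Omega> \<alpha>) ** cmat W))"
    by (simp add: vec_eq_iff)
  have "has_mat_jet (\<lambda>\<Phi>. cscale (of_real \<kappa>)
       (\<Sum>\<alpha>\<in>Sigma0 W N \<Omega>. \<Sum>\<sigma>\<in>UNIV.
          cscale ((omega_pow \<omega> N \<Omega> \<alpha> * of_real (l \<sigma>)) ^ (d - 1))
            (Omega_pow N \<Omega> \<alpha> ** outer (\<Phi> $ \<sigma>) ** transpose (Omega_pow N \<Omega> \<alpha>) ** cmat W))) 0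
     (\<lambda>\<Phi> v. cscale (of_real \<kappa>)
       (\<Sum>\<alpha>\<in>Sigma0 W N \<Omega>. \<Sum>\<sigma>\<in>UNIV.
          cscale ((omega_pow \<omega> N \<Omega> \<alpha> * of_real (l \<sigma>)) ^ (d - 1))
            (Omega_pow N \<Omega> \<alpha> ** sym_outer (\<Phi> $ \<sigma>) (v $ \<sigma>) ** transpose (Omega_pow N \<Omega> \<alpha>) ** cmat W)))"
    by (subst *) (intro has_mat_jet_cscale has_mat_jet_sum has_mat_jet_mult_right
        has_mat_jet_mult_left has_mat_jet_outer)
  then show ?thesis using False
    unfolding lax_coeff_def lax_coeff_jet_def[abs_def] by simp
qed

lemma trace_sum: "trace (\<Sum>i\<in>I. A i) = (\<Sum>i\<in>I. trace (A i))" for A :: "'i \<Rightarrow> complex^'n^'n"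
  unfolding trace_def by (simp add: sum.swap[of _ UNIV])

text \<open>Since \<theta> commutes with \<open>K\<close>, cyclicity of the trace makes all
  \<open>k\<close> terms of the Leibniz sum equal.\<close>

lemma has_jet_trace_lax:
  assumes "\<theta> ** K = K ** \<theta>" "k > 0"
  shows "\<exists>c. has_jet (\<lambda>\<Phi>. trace (\<theta> ** power_coeff (lax_coeff W N \<Omega> \<omega> K \<kappa> l \<Phi>) k d)) c
    (\<lambda>\<Phi> v. of_nat k * trace (\<theta> ** mat_power K (k - 1) ** lax_coeff_jet W N \<Omega> \<omega> \<kappa> l d \<Phi> v))"
proof -
  let ?M = "lax_coeff_jet W N \<Omega> \<omega> \<kappa> l d"
  have "trace (\<theta> ** (\<Sum>a<k. mat_power K a ** ?M \<Phi> v ** mat_power K (k - 1 - a))) =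
      of_nat k * trace (\<theta> ** mat_power K (k - 1) ** ?M \<Phi> v)" for \<Phi> v
  proof -
    have "trace (\<theta> ** (mat_power K a ** ?M \<Phi> v ** mat_power K (k - 1 - a))) =
        trace (\<theta> ** mat_power K (k - 1) ** ?M \<Phi> v)" if "a < k" for a
    proof -
      have "trace (\<theta> ** (mat_power K a ** ?M \<Phi> v ** mat_power K (k - 1 - a))) =
          trace (\<theta> ** mat_power K a ** ?M \<Phi> v ** mat_power K (k - 1 - a))"
        by (simp add: matrix_mul_assoc)
      also have "\<dots> = trace (mat_power K (k - 1 - a) ** (\<theta> ** mat_power K a ** ?M \<Phi> v))"
        by (rule trace_mul_sym)
      also have "mat_power K (k - 1 - a) ** (\<theta> ** mat_power K a ** ?M \<Phi> v) =
          (mat_power K (k - 1 - a) ** \<theta>) ** mat_power K a ** ?M \<Phi> v"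
        by (simp add: matrix_mul_assoc)
      also have "mat_power K (k - 1 - a) ** \<theta> = \<theta> ** mat_power K (k - 1 - a)"
        using assms(1) by (intro mat_power_commute) simp
      also have "\<theta> ** mat_power K (k - 1 - a) ** mat_power K a = \<theta> ** mat_power K (k - 1)"
        using that by (simp flip: matrix_mul_assoc mat_power_add)
      finally show ?thesis .
    qed
    then show ?thesis
      by (simp add: matrix_mult_sum_right trace_sum)
  qed
  moreover have "has_jet (\<lambda>\<Phi>. trace (\<theta> ** power_coeff (lax_coeff W N \<Omega> \<omega> K \<kappa> l \<Phi>) k d))
      (trace (\<theta> ** (if d = 0 then mat_power K k else 0)))
      (\<lambda>\<Phi> v. trace (\<theta> ** (\<Sum>a<k. mat_power K a ** ?M \<Phi> v ** mat_power K (k - 1 - a))))"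
    by (intro has_jet_trace has_mat_jet_mult_left has_mat_jet_power_coeff has_mat_jet_lax_coeff)
  ultimately show ?thesis by auto
qed

section \<open>Conjugation by group elements and symmetry of the quadratic forms\<close>

lemma sp_group_transpose:
  assumes "U \<in> carrier (sp_group W)"
  shows "transpose U ** cmat W = cmat W ** matrix_inv U"
proof -
  have "U ** matrix_inv U = mat 1" using assms by (simp add: sp_group_simps invertible_matrix_inv)
  then have "transpose U ** cmat W = (transpose U ** cmat W ** U) ** matrix_inv U"
    by (simp flip: matrix_mul_assoc)
  then show ?thesis using assms by (simp add: sp_group_simps)
qed

text \<open>The symplectic relation turns \<open>U ** X ** transpose U ** cmat W\<close> into the
  conjugate of \<open>X ** cmat W\<close> by \<open>U\<close>. Cyclicity removes the conjugation,
  and moving \<open>T\<close> past \<open>U\<close> costs the factor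
  \<open>1 / \<nu>\<close>.\<close>

lemma trace_sp_conjugate:
  assumes U: "U \<in> carrier (sp_group W)" and T: "U ** T = cscale \<nu> (T ** U)" and \<nu>: "\<nu> \<noteq> 0"
  shows "trace (T ** (U ** X ** transpose U ** cmat W)) = 1 / \<nu> * trace (T ** X ** cmat W)"
proof -
  have inv: "matrix_inv U ** U = mat 1" using U by (simp add: sp_group_simps invertible_matrix_inv)
  have "T ** (U ** X ** transpose U ** cmat W) = (T ** U) ** (X ** cmat W ** matrix_inv U)"
    by (simp add: sp_group_transpose[OF U] flip: matrix_mul_assoc)
  also have "T ** U = cscale (1 / \<nu>) (U ** T)"
    using \<nu> by (simp add: T cscale_cscale cscale_1)
  finally have "trace (T ** (U ** X ** transpose U ** cmat W)) =
      1 / \<nu> * trace ((U ** T ** X ** cmat W) ** matrix_inv U)"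
    by (simp add: cscale_mult_left trace_cscale matrix_mul_assoc)
  also have "trace ((U ** T ** X ** cmat W) ** matrix_inv U) =
      trace (matrix_inv U ** (U ** T ** X ** cmat W))"
    by (rule trace_mul_sym)
  also have "matrix_inv U ** (U ** T ** X ** cmat W) = T ** X ** cmat W"
    by (simp add: inv matrix_mul_assoc)
  finally show ?thesis .
qed

lemma twisted_commute_mult:
  assumes "A ** X = cscale a (X ** A)" "A ** Y = cscale b (Y ** A)"
  shows "A ** (X ** Y) = cscale (a * b) (X ** Y ** A)"
proof -
  have "A ** (X ** Y) = cscale a (X ** (A ** Y))"
    by (simp add: matrix_mul_assoc assms(1) cscale_mult_left)
  also have "\<dots> = cscale (a * b) (X ** Y ** A)"
    by (simp add: assms(2) cscale_mult_right cscale_cscale matrix_mul_assoc)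
  finally show ?thesis .
qed

lemma twisted_commute_power:
  assumes "A ** X = cscale a (X ** A)"
  shows "A ** mat_power X k = cscale (a ^ k) (mat_power X k ** A)"
proof (induction k)
  case (Suc k)
  from twisted_commute_mult[OF assms this] show ?case by simp
qed (simp add: vec_eq_iff)

lemma twisted_commuteI:
  assumes "invertible A" "A ** X ** matrix_inv A = cscale a X"
  shows "A ** X = cscale a (X ** A)"
proof -
  have "A ** X = A ** X ** matrix_inv A ** A"
    using assms(1) by (simp add: invertible_matrix_inv flip: matrix_mul_assoc)
  then show ?thesis by (simp add: assms(2) cscale_mult_left)
qed

lemma transpose_mat_power: "transpose (mat_power A k) = mat_power (transpose A) k"
proof (induction k)
  case (Suc k)
  then show ?case
    using mat_power_commute[OF refl, of "transpose A" k] by (simp add: matrix_transpose_mul)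
qed simp

text \<open>Transposing \<open>W\<close> gives one sign, each of the \<open>k\<close> factors
  \<open>K\<close> moved past \<open>W\<close> gives another, and \<theta> gives none. For odd
  \<open>k\<close> the signs cancel.\<close>

lemma symmetric_of_twisted_symmetric:
  fixes K \<theta> :: "complex^'m^'m"
  assumes W: "invertible W" "transpose W = - W"
    and K: "transpose K = - (cmat W ** K ** matrix_inv (cmat W))"
    and \<theta>: "transpose \<theta> = cmat W ** \<theta> ** matrix_inv (cmat W)"
    and comm: "\<theta> ** K = K ** \<theta>" and k: "odd k"
  shows "transpose (cmat W ** (\<theta> ** mat_power K k)) = cmat W ** (\<theta> ** mat_power K k)"
proof -
  let ?W = "cmat W"
  obtain V where "W ** V = mat 1" "V ** W = mat 1" using W(1) by (auto simp: invertible_def)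
  then have "?W ** cmat V = mat 1" "cmat V ** ?W = mat 1"
    by (simp_all add: map_matrix_mat_1 flip: cmat_mult)
  then have "invertible ?W" by (auto simp: invertible_def)
  then have inv: "matrix_inv ?W ** ?W = mat 1" by (rule invertible_matrix_inv)
  have "transpose ?W = cmat (transpose W)" by (simp add: vec_eq_iff transpose_def)
  also have "\<dots> = - ?W" unfolding W(2) by (simp add: vec_eq_iff)
  finally have WT: "transpose ?W = - ?W" .
  have KW: "transpose K ** ?W = - (?W ** K)"
    unfolding K minus_mult_mat by (simp add: inv flip: matrix_mul_assoc)
  have \<theta>W: "transpose \<theta> ** ?W = ?W ** \<theta>"
    unfolding \<theta> by (simp add: inv flip: matrix_mul_assoc)
  have KkW: "mat_power (transpose K) k ** ?W = (if even k then ?W ** mat_power K k else - (?W ** mat_power K k))" for k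
  proof (induction k)
    case (Suc k)
    have "mat_power (transpose K) (Suc k) ** ?W = transpose K ** (mat_power (transpose K) k ** ?W)"
      by (simp add: matrix_mul_assoc)
    then show ?case
      by (simp add: Suc minus_mult_mat matrix_mul_assoc KW)
  qed simp
  have "transpose (?W ** (\<theta> ** mat_power K k)) = - (mat_power (transpose K) k ** (transpose \<theta> ** ?W))"
    by (simp add: matrix_transpose_mul transpose_mat_power WT minus_mult_mat matrix_mul_assoc)
  also have "\<dots> = - ((mat_power (transpose K) k ** ?W) ** \<theta>)"
    by (simp add: \<theta>W matrix_mul_assoc)
  also have "\<dots> = ?W ** (mat_power K k ** \<theta>)"
    using k by (simp add: KkW minus_mult_mat matrix_mul_assoc)
  also have "mat_power K k ** \<theta> = \<theta> ** mat_power K k"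
    using comm by (intro mat_power_commute) simp
  finally show ?thesis .
qed

text \<open>The trace is the polarized quadratic form of \<open>cmat W ** T\<close>; by symmetry its
  two halves agree, whence the factor 2.\<close>

lemma trace_sym_outer:
  assumes sym: "transpose (cmat W ** T) = cmat W ** T"
  shows "trace (T ** sym_outer x v ** cmat W) =
    2 * (\<Sum>i\<in>UNIV. ((cmat W ** T) *v (\<chi> i. of_real (x $ i))) $ i * of_real (v $ i))"
proof -
  define S where "S = cmat W ** T"
  have S: "S $ i $ j = S $ j $ i" for i j
    using sym unfolding S_def[symmetric] by (metis transpose_def vec_lambda_beta)
  have "trace (T ** sym_outer x v ** cmat W) = trace (cmat W ** (T ** sym_outer x v))"
    by (rule trace_mul_sym)
  also have "\<dots> = trace (S ** sym_outer x v)" by (simp add: S_def matrix_mul_assoc)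
  also have "\<dots> = (\<Sum>i\<in>UNIV. \<Sum>j\<in>UNIV. S $ i $ j * of_real (x $ j) * of_real (v $ i)) +
      (\<Sum>i\<in>UNIV. \<Sum>j\<in>UNIV. S $ j $ i * of_real (x $ i) * of_real (v $ j))"
    by (simp add: trace_def matrix_matrix_mult_def sym_outer_def algebra_simps sum.distrib S[symmetric])
  also have "(\<Sum>i\<in>UNIV. \<Sum>j\<in>UNIV. S $ j $ i * of_real (x $ i) * of_real (v $ j)) =
      (\<Sum>i\<in>UNIV. \<Sum>j\<in>UNIV. S $ i $ j * of_real (x $ j) * of_real (v $ i))"
    by (rule sum.swap)
  finally show ?thesis
    by (simp add: S_def matrix_vector_mult_def sum_distrib_right)
qed

section \<open>The character and the sum over multi-indices\<close>

lemma hom_circle_group: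
  assumes G0: "subgroup G0 (sp_group W)"
    and \<omega>: "\<omega> \<in> hom (sp_group W\<lparr>carrier := G0\<rparr>) circle_group"
  shows "A \<in> G0 \<Longrightarrow> B \<in> G0 \<Longrightarrow> A ** B \<in> G0 \<and> \<omega> (A ** B) = \<omega> A * \<omega> B"
    and "mat 1 \<in> G0" "\<omega> (mat 1) = 1"
    and "A \<in> G0 \<Longrightarrow> norm (\<omega> A) = 1"
    and "A \<in> G0 \<Longrightarrow> mat_power A k \<in> G0 \<and> \<omega> (mat_power A k) = \<omega> A ^ k"
proof -
  show one: "mat 1 \<in> G0" using subgroup.one_closed[OF G0] by (simp add: sp_group_simps)
  show mult: "A ** B \<in> G0 \<and> \<omega> (A ** B) = \<omega> A * \<omega> B" if "A \<in> G0" "B \<in> G0" for A B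
    using subgroup.m_closed[OF G0 that] hom_mult[OF \<omega>, of A B] that
    by (simp add: sp_group_def circle_group_def)
  show norm: "norm (\<omega> A) = 1" if "A \<in> G0" for A
    using hom_in_carrier[OF \<omega>, of A] that by (simp add: circle_group_def)
  have "\<omega> (mat 1) * \<omega> (mat 1) = \<omega> (mat 1)" using mult[OF one one] by simp
  moreover have "\<omega> (mat 1) \<noteq> 0" using norm[OF one] by auto
  ultimately show "\<omega> (mat 1) = 1" by simp
  then show "mat_power A k \<in> G0 \<and> \<omega> (mat_power A k) = \<omega> A ^ k" if "A \<in> G0" for A k
    by (induction k) (simp_all add: one mult that)
qed

lemma Omega_pow_properties:
  assumes G0: "subgroup G0 (sp_group W)"
    and \<omega>: "\<omega> \<in> hom (sp_group W\<lparr>carrier := G0\<rparr>) circle_group"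
    and \<Omega>: "\<And>a. a \<in> {1..N} \<Longrightarrow> \<Omega> a \<in> G0"
  shows "Omega_pow N \<Omega> \<alpha> \<in> G0" "\<omega> (Omega_pow N \<Omega> \<alpha>) = omega_pow \<omega> N \<Omega> \<alpha>"
proof -
  note hom = hom_circle_group[OF G0 \<omega>]
  have "foldr (\<lambda>a B. mat_power (\<Omega> a) (\<alpha> a) ** B) xs (mat 1) \<in> G0 \<and>
      \<omega> (foldr (\<lambda>a B. mat_power (\<Omega> a) (\<alpha> a) ** B) xs (mat 1)) = (\<Prod>a\<leftarrow>xs. \<omega> (\<Omega> a) ^ \<alpha> a)"
    if "set xs \<subseteq> {1..N}" for xs
    using that by (induction xs) (simp_all add: hom \<Omega>)
  from this[of "[1..<Suc N]"] show "Omega_pow N \<Omega> \<alpha> \<in> G0" "\<omega> (Omega_pow N \<Omega> \<alpha>) = omega_pow \<omega> N \<Omega> \<alpha>"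
    by (auto simp add: Omega_pow_def omega_pow_def prod.distinct_set_conv_list[symmetric]
       atLeastLessThanSuc_atLeastAtMost simp del: upt_Suc)
qed

text \<open>The power of each generator to its projective order is plus or minus the identity, where
  \<omega> is 1, and \<open>m0\<close> is a multiple of all these orders.\<close>

lemma omega_pow_m0:
  assumes G0: "subgroup G0 (sp_group W)" "finite G0"
    and \<omega>: "\<omega> \<in> hom (sp_group W\<lparr>carrier := G0\<rparr>) circle_group"
      "- mat 1 \<in> G0 \<Longrightarrow> \<omega> (- mat 1) = 1"
    and \<Omega>: "\<And>a. a \<in> {1..N} \<Longrightarrow> \<Omega> a \<in> G0"
  shows "omega_pow \<omega> N \<Omega> \<alpha> ^ m0 W N \<Omega> = 1"
proof -
  note hom = hom_circle_group[OF G0(1) \<omega>(1)]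
  have "\<omega> (\<Omega> a) ^ m0 W N \<Omega> = 1" if a: "a \<in> {1..N}" for a
  proof -
    have "mat_power (\<Omega> a) (pr_ord W (\<Omega> a)) \<in> {mat 1, - mat 1}"
      using pr_ord_properties(2)[OF G0] \<Omega> a by blast
    moreover have "mat_power (\<Omega> a) (pr_ord W (\<Omega> a)) \<in> G0"
      using hom(5) \<Omega> a by blast
    ultimately have "\<omega> (mat_power (\<Omega> a) (pr_ord W (\<Omega> a))) = 1"
      using \<omega>(2) hom(3) by auto
    then have "\<omega> (\<Omega> a) ^ pr_ord W (\<Omega> a) = 1" using hom(5) \<Omega> a by simp
    moreover have "pr_ord W (\<Omega> a) dvd m0 W N \<Omega>" unfolding m0_def using a by (intro dvd_Lcm) simp
    ultimately show ?thesis by (metis dvdE power_mult power_one)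
  qed
  then have "(\<Prod>a\<in>{1..N}. (\<omega> (\<Omega> a) ^ m0 W N \<Omega>) ^ \<alpha> a) = 1" by simp
  then show ?thesis
    by (simp add: omega_pow_def prod_power_distrib mult.commute flip: power_mult)
qed

text \<open>Conjugation contributes the inverse of
  \<open>omega_pow \<omega> N \<Omega> \<alpha> ^ e\<close>, which cancels the power coming from the
  pole because \<omega>-powers have \<open>m\<close>-th power 1. So every multi-index contributes
  the same amount. The index is a successor because degree \<open>d\<close> carries the exponent
  \<open>d - 1\<close>.\<close>

lemma trace_lax_coeff_jet:
  assumes T: "\<And>\<alpha>. Omega_pow N \<Omega> \<alpha> ** T = cscale (omega_pow \<omega> N \<Omega> \<alpha> ^ e) (T ** Omega_pow N \<Omega> \<alpha>)"
    and \<Omega>: "\<And>\<alpha>. Omega_pow N \<Omega> \<alpha> \<in> carrier (sp_group W)"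
    and \<omega>: "\<And>\<alpha>. omega_pow \<omega> N \<Omega> \<alpha> \<noteq> 0" "\<And>\<alpha>. omega_pow \<omega> N \<Omega> \<alpha> ^ m = 1"
  shows "trace (T ** lax_coeff_jet W N \<Omega> \<omega> \<kappa> l (Suc (m * q + e)) \<Phi> v) =
     of_real (\<kappa> * real (card (Sigma0 W N \<Omega>))) *
       (\<Sum>\<sigma>\<in>UNIV. of_real (l \<sigma> ^ (m * q + e)) * trace (T ** sym_outer (\<Phi> $ \<sigma>) (v $ \<sigma>) ** cmat W))"
proof -
  let ?U = "Omega_pow N \<Omega>" and ?t = "\<lambda>\<sigma>. trace (T ** sym_outer (\<Phi> $ \<sigma>) (v $ \<sigma>) ** cmat W)"
  have "(omega_pow \<omega> N \<Omega> \<alpha> * of_real (l \<sigma>)) ^ (m * q + e) *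
      trace (T ** (?U \<alpha> ** sym_outer (\<Phi> $ \<sigma>) (v $ \<sigma>) ** transpose (?U \<alpha>) ** cmat W)) =
      of_real (l \<sigma> ^ (m * q + e)) * ?t \<sigma>" for \<alpha> \<sigma>
    using \<omega> trace_sp_conjugate[OF \<Omega> T]
    by (simp add: power_mult_distrib power_add power_mult)
  then show ?thesis
    by (simp add: lax_coeff_jet_def cscale_mult_right trace_cscale matrix_mult_sum_right trace_sum)
qed

text \<open>All projective orders are positive. The first claim keeps the constant in the quadratic
  parts non-zero; the second makes \<open>m0\<close>-th powers distinguish absolute values.\<close>

lemma card_Sigma0_pos:
  assumes G0: "subgroup G0 (sp_group W)" "finite G0"
    and \<Omega>: "\<And>a. a \<in> {1..N} \<Longrightarrow> \<Omega> a \<in> G0"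
  shows "card (Sigma0 W N \<Omega>) > 0" "m0 W N \<Omega> > 0"
proof -
  have pos: "pr_ord W (\<Omega> a) > 0" if "a \<in> {1..N}" for a
    using pr_ord_properties(1)[OF G0] \<Omega> that by blast
  then show "card (Sigma0 W N \<Omega>) > 0"
    by (simp add: Sigma0_def card_PiE prod_pos)
  show "m0 W N \<Omega> > 0"
    using pos unfolding m0_def by (force intro!: Nat.gr0I simp: Lcm_0_iff)
qed

text \<open>Real independence of matrices with real entries extends to complex coefficients by
  splitting the coefficients into real and imaginary parts.\<close>

lemma indep_funs_of_real_matrices:
  fixes T :: "'i \<Rightarrow> complex^'m^'m"
  assumes I: "finite I" and indep: "independent_family I T"
    and real: "\<And>j. j \<in> I \<Longrightarrow> conj_mat (T j) = T j"
  shows "indep_funs I (\<lambda>j (p, q). T j $ p $ q)"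
  unfolding indep_funs_def
proof (intro allI impI ballI)
  fix a j assume a: "\<forall>v. (\<Sum>j\<in>I. a j * (case v of (p, q) \<Rightarrow> T j $ p $ q)) = 0" and j: "j \<in> I"
  have Im: "Im (T j $ p $ q) = 0" if "j \<in> I" for j p q
  proof -
    have "cnj (T j $ p $ q) = T j $ p $ q"
      using arg_cong[OF real[OF that], of "\<lambda>A. A $ p $ q"] by simp
    then show ?thesis by (simp add: complex_eq_iff)
  qed
  have zero: "(\<Sum>j\<in>I. a j * T j $ p $ q) = 0" for p q using a by force
  have "(\<Sum>j\<in>I. Re (a j) *\<^sub>R T j) $ p $ q = 0" for p q
    using arg_cong[OF zero[of p q], of Re]
    by (simp add: complex_eq_iff Im cong: sum.cong)
  then have "(\<Sum>j\<in>I. Re (a j) *\<^sub>R T j) = 0" by (simp add: vec_eq_iff)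
  then have Re0: "Re (a j) = 0" by (rule independent_familyD[OF indep I _ j])
  have "(\<Sum>j\<in>I. Im (a j) *\<^sub>R T j) $ p $ q = 0" for p q
    using arg_cong[OF zero[of p q], of Im]
    by (simp add: complex_eq_iff Im cong: sum.cong)
  then have "(\<Sum>j\<in>I. Im (a j) *\<^sub>R T j) = 0" by (simp add: vec_eq_iff)
  then have Im0: "Im (a j) = 0" by (rule independent_familyD[OF indep I _ j])
  from Re0 Im0 show "a j = 0" by (simp add: complex_eq_iff)
qed

text \<open>Multiplication by the invertible \<open>W\<close> preserves independence, and since all
  entries are real, taking \<open>Re\<close> loses nothing.\<close>

lemma indep_funs_Re_separating:
  fixes W :: "real^'m^'m" and T :: "'i \<Rightarrow> complex^'m^'m"
  assumes W: "invertible W" and I: "finite I"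
    and real: "\<And>j. j \<in> I \<Longrightarrow> conj_mat (T j) = T j"
    and indep: "indep_funs I (\<lambda>j p. (T j *v (\<chi> i. of_real (u $ i))) $ p)"
  shows "indep_funs I (\<lambda>j p. Re (((cmat W ** T j) *v (\<chi> i. of_real (u $ i))) $ p))"
    and "j \<in> I \<Longrightarrow> ((cmat W ** T j) *v (\<chi> i. of_real (u $ i))) $ p \<in> \<real>"
proof -
  let ?u = "\<chi> i. complex_of_real (u $ i)"
  show "((cmat W ** T j) *v ?u) $ p \<in> \<real>" if "j \<in> I" for j p
  proof -
    have "T j $ p $ q \<in> \<real>" for p q
      using arg_cong[OF real[OF that], of "\<lambda>A. A $ p $ q"] by (simp add: Reals_cnj_iff)
    then show ?thesis
      by (auto simp: matrix_vector_mult_def matrix_matrix_mult_def intro!: sum_in_Reals Reals_mult)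
  qed
  then have Re: "of_real (Re (((cmat W ** T j) *v ?u) $ p)) = ((cmat W ** T j) *v ?u) $ p" if "j \<in> I" for j p
    using that by (metis of_real_Re)
  obtain V where "V ** W = mat 1" using W by (auto simp: invertible_def)
  then have V: "cmat V ** cmat W = mat 1" by (simp add: map_matrix_mat_1 flip: cmat_mult)
  show "indep_funs I (\<lambda>j p. Re (((cmat W ** T j) *v ?u) $ p))"
    unfolding indep_funs_def
  proof (intro allI impI)
    fix a :: "'i \<Rightarrow> real"
    assume a: "\<forall>p. (\<Sum>j\<in>I. a j * Re (((cmat W ** T j) *v ?u) $ p)) = 0"
    have "(\<Sum>j\<in>I. of_real (a j) * ((cmat W ** T j) *v ?u) $ p) = 0" for p
    proof -
      have "(\<Sum>j\<in>I. of_real (a j) * ((cmat W ** T j) *v ?u) $ p) =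
          of_real (\<Sum>j\<in>I. a j * Re (((cmat W ** T j) *v ?u) $ p))"
        unfolding of_real_sum of_real_mult by (intro sum.cong) (simp_all only: Re)
      then show ?thesis using a by simp
    qed
    then have "(\<Sum>j\<in>I. of_real (a j) *s ((cmat W ** T j) *v ?u)) = 0" by (simp add: vec_eq_iff)
    then have "cmat V *v (\<Sum>j\<in>I. of_real (a j) *s ((cmat W ** T j) *v ?u)) = 0" by simp
    then have "(\<Sum>j\<in>I. of_real (a j) *s (T j *v ?u)) = 0"
      by (simp add: vec.sum vec.scale matrix_vector_mul_assoc matrix_mul_assoc V)
    then have "\<forall>p. (\<Sum>j\<in>I. of_real (a j) * (T j *v ?u) $ p) = 0" by (simp add: vec_eq_iff)
    from indep[unfolded indep_funs_def, rule_format, OF this[rule_format]]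
    show "\<forall>j\<in>I. a j = 0" by simp
  qed
qed

section \<open>Generic independence from quadratic parts at a point with equal columns\<close>

theorem theorem6:
  fixes W :: "real^'m^'m" and n N :: nat
    and G0 :: "(complex^'m^'m) set"
    and \<Omega> :: "nat \<Rightarrow> complex^'m^'m"
    and \<omega> :: "complex^'m^'m \<Rightarrow> complex"
    and K :: "complex^'m^'m"
    and \<kappa> :: real
    and l :: "'r::finite \<Rightarrow> real"
    and \<theta> :: "nat \<Rightarrow> complex^'m^'m"
    and h :: "nat \<Rightarrow> nat"
  assumes dim: "CARD('m) = 2 * n"
    and W: "invertible W" "transpose W = - W"
    and G0: "subgroup G0 (sp_group W)" "finite G0"
      "\<And>A. A \<in> G0 \<Longrightarrow> conj_mat A ** A = mat 1 \<or> conj_mat A ** A = - mat 1"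
    and \<Omega>: "\<And>a. a \<in> {1..N} \<Longrightarrow> \<Omega> a \<in> G0"
      "generate (proj_group W) ((\<lambda>a. pr W (\<Omega> a)) ` {1..N}) = pr W ` G0"
    and \<omega>: "\<omega> \<in> hom (sp_group W\<lparr>carrier := G0\<rparr>) circle_group"
      "- mat 1 \<in> G0 \<Longrightarrow> \<omega> (- mat 1) = 1"
    and l: "\<And>\<sigma>. l \<sigma> \<noteq> 0" "inj (\<lambda>\<sigma>. (l \<sigma>)\<^sup>2)"
    and \<kappa>: "\<kappa> \<noteq> 0"
    and K: "K \<in> reduced_D1 W G0 \<omega>" "mat_diagonalizable K"
    and \<theta>: "\<And>k. k \<in> {1..n} \<Longrightarrow> \<theta> k \<in> Theta W G0 \<omega> (int (h k))"
      "\<And>j k. j \<in> {1..n} \<Longrightarrow> k \<in> {1..n} \<Longrightarrow> \<theta> j ** \<theta> k - \<theta> k ** \<theta> j = 0"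
      "independent_family {1..n} (\<lambda>j. \<theta> j ** mat_power K (2 * j - 1))"
  shows "\<exists>U :: (real^'m^'r) set. open U \<and> closure U = UNIV \<and>
    (\<forall>\<Phi>\<in>U. functionally_independent_at ({1..n} \<times> {1..CARD('r)})
      (\<lambda>(k, p) \<Phi>. E_fun W N \<Omega> \<omega> K \<kappa> l (h k) (\<theta> k) k p \<Phi>) \<Phi>)"
proof -
  define I where "I = {1..n} \<times> {1..CARD('r)}"
  define T where "T k = \<theta> k ** mat_power K (2 * k - 1)" for k
  define m where "m = m0 W N \<Omega>"
  \<comment> \<open>The weight of \<open>T k\<close> under conjugation, \<open>h k\<close> from
    \<open>\<theta> k\<close> plus \<open>2 * k - 1\<close> from the power of \<open>K\<close>. It
    is also the exponent \<open>d - 1\<close> for the index \<open>d\<close> belonging to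
    \<open>p = 1\<close>.\<close>
  define e where "e k = 2 * k + h k - 1" for k
  note hom = hom_circle_group[OF G0(1) \<omega>(1)]
  have inv_G0: "invertible A" if "A \<in> G0" for A
    using that subgroup.subset[OF G0(1)] by (auto simp: sp_group_simps)

  have K_transpose: "transpose K = - (cmat W ** K ** matrix_inv (cmat W))" and K_real: "conj_mat K = K"
    and K_tw: "\<And>A. A \<in> G0 \<Longrightarrow> A ** K = cscale (\<omega> A) (K ** A)"
    using K(1) inv_G0 by (auto simp: reduced_D1_def sp_algebra_def intro: twisted_commuteI)
  have "\<forall>k\<in>{1..n}. \<exists>c g. norm c = 1 \<and> g \<in> G0 \<and> \<theta> k = cscale c g \<and> \<omega> g = 1"
    using \<theta>(1) unfolding Theta_def by blast
  then obtain c g where cg: "\<And>k. k \<in> {1..n} \<Longrightarrow> norm (c k) = 1 \<and> g k \<in> G0 \<and> \<theta> k = cscale (c k) (g k) \<and> \<omega> (g k) = 1"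
    by metis
  have \<theta>_real: "conj_mat (\<theta> k) = \<theta> k"
    and \<theta>_transpose: "transpose (\<theta> k) = cmat W ** \<theta> k ** matrix_inv (cmat W)"
    and \<theta>_tw: "\<And>A. A \<in> G0 \<Longrightarrow> A ** \<theta> k = cscale (\<omega> A ^ h k) (\<theta> k ** A)"
    if "k \<in> {1..n}" for k
    using \<theta>(1)[OF that] inv_G0 by (auto simp: Theta_def intro: twisted_commuteI)
  \<comment> \<open>The twisted relation for \<open>K\<close>, applied to the group element
    \<open>g k\<close> itself, where \<omega> is 1.\<close>
  have gK: "g k ** K = K ** g k" if "k \<in> {1..n}" for k
    using K_tw[of "g k"] cg[OF that] by (simp add: cscale_1)
  have \<theta>K: "\<theta> k ** K = K ** \<theta> k" if "k \<in> {1..n}" for k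
    using cg[OF that] gK[OF that] by (simp add: cscale_mult_left cscale_mult_right)
  have T_real: "conj_mat (T k) = T k" if "k \<in> {1..n}" for k
    using \<theta>_real[OF that] by (simp add: T_def conj_mat_mult conj_mat_power K_real)

  \<comment> \<open>The eigenvector argument is run with the \<open>g k\<close>, whose membership in
    \<open>G0\<close> gives finite order; they commute because the \<open>\<theta> k\<close> differ
    from them by non-zero scalars.\<close>
  have "g j ** g k = g k ** g j" if "j \<in> {1..n}" "k \<in> {1..n}" for j k
  proof -
    have "cscale (c j * c k) (g j ** g k) = cscale (c j * c k) (g k ** g j)"
      using \<theta>(2)[OF that] cg[OF that(1)] cg[OF that(2)]
      by (simp add: cscale_mult_left cscale_mult_right cscale_cscale mult.commute)
    moreover have "c j * c k \<noteq> 0" using cg[OF that(1)] cg[OF that(2)] by auto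
    ultimately show ?thesis using cscale_cancel by blast
  qed
  then have span: "vec.span (joint_eigenvectors (insert K (g ` {1..n}))) = UNIV"
    using cg gK finite_order_mat[OF G0(1,2)]
    by (intro span_joint_eigenvectors K(2)) (auto simp del: atLeastAtMost_iff)
  have "\<exists>\<mu>. T k *v x = \<mu> *s x" if k: "k \<in> {1..n}" and x: "x \<in> joint_eigenvectors (insert K (g ` {1..n}))" for k x
  proof -
    obtain \<mu> \<nu> where "K *v x = \<mu> *s x" and \<nu>: "g k *v x = \<nu> *s x"
      using x k unfolding joint_eigenvectors_def by blast
    then have "mat_power K (2 * k - 1) *v x = \<mu> ^ (2 * k - 1) *s x"
      by (intro mat_power_eigenvector)
    then have "T k *v x = (\<mu> ^ (2 * k - 1) * (c k * \<nu>)) *s x"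
      using cg[OF k] \<nu>
      by (simp add: T_def cscale_vector_mult vec.scale flip: matrix_vector_mul_assoc)
    then show ?thesis ..
  qed
  with span have "\<exists>v. indep_funs {1..n} (\<lambda>k p. (T k *v v) $ p)"
    using \<theta>(3) T_real
    by (intro exists_separating_vector indep_funs_of_real_matrices) (auto simp: T_def[abs_def])
  then obtain u :: "real^'m" where u: "indep_funs {1..n} (\<lambda>k p. (T k *v (\<chi> i. of_real (u $ i))) $ p)"
    using exists_real_separating_vector[of "{1..n}" T] by auto

  define s where "s k i = Re (((cmat W ** T k) *v (\<chi> i. of_real (u $ i))) $ i)" for k i
  have s_indep: "indep_funs {1..n} s"
    unfolding s_def[abs_def] using T_real u by (intro indep_funs_Re_separating W(1)) auto
  have s: "((cmat W ** T k) *v (\<chi> i. of_real (u $ i))) $ i = of_real (s k i)" if "k \<in> {1..n}" for k i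
    using indep_funs_Re_separating(2)[OF W(1) _ T_real u that, of i] by (simp add: s_def of_real_Re)
  define \<Phi>0 :: "real^'m^'r" where "\<Phi>0 = (\<chi> \<sigma>. u)"

  let ?d = "\<lambda>k p. m * (p - 1) + 2 * k + h k"
  \<comment> \<open>The explicit form of the functions before the real part is taken.\<close>
  define f where "f = (\<lambda>(k, p) \<Phi>. of_real (1 / (2 * real k)) *
    trace (\<theta> k ** power_coeff (lax_coeff W N \<Omega> \<omega> K \<kappa> l \<Phi>) (2 * k) (?d k p)))"
  define Q where "Q = (\<lambda>(k, p) \<Phi> v. trace (T k ** lax_coeff_jet W N \<Omega> \<omega> \<kappa> l (?d k p) \<Phi> v))"
  have "\<exists>c. has_jet (f x) c (Q x)" if x: "x \<in> I" for x
  proof -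
    obtain k p where kp: "x = (k, p)" "k \<in> {1..n}" "p \<in> {1..CARD('r)}" using x by (auto simp: I_def)
    have "\<exists>c. has_jet (\<lambda>\<Phi>. trace (\<theta> k ** power_coeff (lax_coeff W N \<Omega> \<omega> K \<kappa> l \<Phi>) (2 * k) (?d k p))) c
        (\<lambda>\<Phi> v. of_nat (2 * k) * trace (T k ** lax_coeff_jet W N \<Omega> \<omega> \<kappa> l (?d k p) \<Phi> v))"
      unfolding T_def using kp(2) by (intro has_jet_trace_lax \<theta>K) auto
    then obtain c where "has_jet (\<lambda>\<Phi>. trace (\<theta> k ** power_coeff (lax_coeff W N \<Omega> \<omega> K \<kappa> l \<Phi>) (2 * k) (?d k p))) c
        (\<lambda>\<Phi> v. of_nat (2 * k) * trace (T k ** lax_coeff_jet W N \<Omega> \<omega> \<kappa> l (?d k p) \<Phi> v))" ..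
    \<comment> \<open>The normalization \<open>1 / (2 * real k)\<close> cancels the factor
      \<open>2 * k\<close> from the Leibniz sum.\<close>
    from has_jet_mult[OF has_jet_const this, of "of_real (1 / (2 * real k))"] kp
    show ?thesis by (auto simp: f_def Q_def)
  qed
  then obtain c0 where jet: "\<And>x. x \<in> I \<Longrightarrow> has_jet (f x) (c0 x) (Q x)" by metis

  \<comment> \<open>The 2 comes from polarization, \<kappa> from the Lax matrix, and the cardinality
    from the equal contributions of the multi-indices.\<close>
  define C where "C = 2 * \<kappa> * real (card (Sigma0 W N \<Omega>))"
  have Q_eq: "Re (Q (k, p) \<Phi>0 v) =
      C * (\<Sum>\<sigma>\<in>UNIV. l \<sigma> ^ (m * (p - 1) + e k) * (\<Sum>i\<in>UNIV. s k i * v $ \<sigma> $ i))"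
    if k: "k \<in> {1..n}" for k p v
  proof -
    have d: "?d k p = Suc (m * (p - 1) + e k)" using k by (simp add: e_def)
    have sym: "transpose (cmat W ** T k) = cmat W ** T k"
      unfolding T_def using k
      by (intro symmetric_of_twisted_symmetric W K_transpose \<theta>_transpose \<theta>K) auto
    have tr: "trace (T k ** sym_outer (\<Phi>0 $ \<sigma>) (v $ \<sigma>) ** cmat W) =
        of_real (2 * (\<Sum>i\<in>UNIV. s k i * v $ \<sigma> $ i))" for \<sigma>
      using trace_sym_outer[OF sym, of u "v $ \<sigma>"] by (simp add: \<Phi>0_def s[OF k])
    note pow = Omega_pow_properties[OF G0(1) \<omega>(1) \<Omega>(1)]
    have "trace (T k ** lax_coeff_jet W N \<Omega> \<omega> \<kappa> l (Suc (m * (p - 1) + e k)) \<Phi>0 v) =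
     of_real (\<kappa> * real (card (Sigma0 W N \<Omega>))) *
       (\<Sum>\<sigma>\<in>UNIV. of_real (l \<sigma> ^ (m * (p - 1) + e k)) * trace (T k ** sym_outer (\<Phi>0 $ \<sigma>) (v $ \<sigma>) ** cmat W))"
    proof (rule trace_lax_coeff_jet)
      fix \<alpha>
      let ?U = "Omega_pow N \<Omega> \<alpha>"
      have U: "?U \<in> G0" "\<omega> ?U = omega_pow \<omega> N \<Omega> \<alpha>" using pow by auto
      have "?U ** T k = cscale (\<omega> ?U ^ h k * \<omega> ?U ^ (2 * k - 1)) (T k ** ?U)"
        unfolding T_def using U k by (intro twisted_commute_mult \<theta>_tw twisted_commute_power K_tw)
      moreover have "h k + (2 * k - 1) = e k" using k by (simp add: e_def)
      ultimately show "?U ** T k = cscale (omega_pow \<omega> N \<Omega> \<alpha> ^ e k) (T k ** ?U)"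
        by (simp add: U(2) flip: power_add)
      show "?U \<in> carrier (sp_group W)" using U(1) subgroup.subset[OF G0(1)] by blast
      have "norm (\<omega> ?U) = 1" using hom(4) U(1) by blast
      then show "omega_pow \<omega> N \<Omega> \<alpha> \<noteq> 0" using U(2) by auto
      show "omega_pow \<omega> N \<Omega> \<alpha> ^ m = 1"
        unfolding m_def using G0(1,2) \<omega> \<Omega>(1) by (rule omega_pow_m0)
    qed
    also have "\<dots> = of_real (C * (\<Sum>\<sigma>\<in>UNIV. l \<sigma> ^ (m * (p - 1) + e k) * (\<Sum>i\<in>UNIV. s k i * v $ \<sigma> $ i)))"
      unfolding tr by (simp add: C_def sum_distrib_left mult_ac)
    finally show ?thesis unfolding Q_def prod.case d by (simp only: Re_complex_of_real)
  qed
  have card_pos: "card (Sigma0 W N \<Omega>) > 0" "m > 0"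
    unfolding m_def using card_Sigma0_pos[OF G0(1,2) \<Omega>(1)] by auto
  \<comment> \<open>Positive powers determine absolute values, hence squares, and the squares are
    distinct; the parity of \<open>m\<close> does not matter.\<close>
  have "inj (\<lambda>\<sigma>. l \<sigma> ^ m)"
  proof (rule injI)
    fix \<sigma> \<tau> assume "l \<sigma> ^ m = l \<tau> ^ m"
    then have "\<bar>l \<sigma>\<bar> ^ m = \<bar>l \<tau>\<bar> ^ m" by (metis power_abs)
    then have "\<bar>l \<sigma>\<bar> = \<bar>l \<tau>\<bar>" using card_pos(2) by (auto dest: power_eq_imp_eq_base)
    then have "(l \<sigma>)\<^sup>2 = (l \<tau>)\<^sup>2" by (metis power2_abs)
    then show "\<sigma> = \<tau>" using l(2) by (simp add: inj_def)
  qed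
  moreover have "C \<noteq> 0" using \<kappa> card_pos(1) by (simp add: C_def)
  ultimately have "indep_funs I (\<lambda>(k, p) (v :: real^'m^'r).
      C * (\<Sum>\<sigma>\<in>UNIV. l \<sigma> ^ (m * (p - 1) + e k) * (\<Sum>i\<in>UNIV. s k i * v $ \<sigma> $ i)))"
    unfolding I_def using s_indep l(1) by (intro indep_funs_vandermonde)
  then have "indep_funs I (\<lambda>x v. Re (Q x \<Phi>0 v))"
    by (rule indep_funs_cong[THEN iffD1, rotated]) (auto simp: I_def Q_eq)
  then have "\<exists>U. open U \<and> closure U = UNIV \<and>
      (\<forall>\<Phi>\<in>U. functionally_independent_at I (\<lambda>x \<Phi>. Re (f x \<Phi>)) \<Phi>)"
    by (intro functionally_independent_of_jets[of I f c0 Q] jet) (auto simp: I_def)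
  moreover have "(\<lambda>x \<Phi>. Re (f x \<Phi>)) =
      (\<lambda>(k, p) \<Phi>. E_fun W N \<Omega> \<omega> K \<kappa> l (h k) (\<theta> k) k p \<Phi>)"
    by (simp add: fun_eq_iff f_def E_fun_def coeffs_at_infinity_trace_lax m_def)
  ultimately show ?thesis by (simp only: I_def)
qed

end
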